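(* Let $R$ be a domain of positive characteristic which is not a field. Then, in the chain of subgroups $$\mathrm{T}_2(R)\subset \mathrm{T}^{\mathrm g}_2(R)\subset \mathrm{T}^{\mathrm d}_2(R)\subset \mathrm{Aut}_R R[x_1,x_2],$$ $\mathrm{T}_2(R)$ is not a normal subgroup of $\mathrm{T}^{\mathrm g}_2(R)$, $\mathrm{T}^{\mathrm g}_2(R)$ is not a normal subgroup of $\mathrm{T}^{\mathrm d}_2(R)$, and $\mathrm{T}^{\mathrm d}_2(R)$ is not a normal subgroup of $\mathrm{Aut}_R R[x_1,x_2]$. In particular, $\mathrm{T}_2(R)$, $\mathrm{T}^{\mathrm g}_2(R)$, $\mathrm{T}^{\mathrm d}_2(R)$ and $\mathrm{Aut}_R R[x_1,x_2]$ are different.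
   Context: $\mathrm{Aut}_R R[x_1,x_2]$ is the group (under composition) of $R$-algebra automorphisms of the polynomial ring $R[x_1,x_2]$; an automorphism $\phi$ is identified with the pair $(\phi(x_1),\phi(x_2))$. $\langle H_1,\dots,H_r\rangle$ denotes the subgroup generated by $H_1\cup\dots\cup H_r$. An automorphism $\phi$ is affine if $(\phi(x_1),\phi(x_2))=(x_1,x_2)M+(b_1,b_2)$ for some $M\in \mathrm{GL}_2(R)$ and $(b_1,b_2)\in R^2$; it is a translation if moreover $M$ is the identity matrix. $\phi$ is elementary if there are $l\in\{1,2\}$, $a\in R^\times$ and $f\in R[x_m]$ (where $\{l,m\}=\{1,2\}$) with $\phi(x_l)=ax_l+f$ and $\phi(x_m)=x_m$. $\mathrm{Aff}_2(R)$ is the subgroup of affine automorphisms, $\mathrm{E}_2(R)$ is the subgroup generated by the elementary automorphisms, and $\mathrm{T}_2(R)=\langle \mathrm{Aff}_2(R),\mathrm{E}_2(R)\rangle$. A polynomial $f\in R[x_1,x_2]$ is additive if $f(y_1+z_1,y_2+z_2)=f(y_1,y_2)+f(z_1,z_2)$ for indeterminates $y_1,y_2,z_1,z_2$ over $R$. $\mathrm{Add}_2(R)$ is the subgroup of those $\phi\in\mathrm{Aut}_R R[x_1,x_2]$ such that $\phi(x_1),\phi(x_2)$ are additive. $\mathrm{Aff}^{\mathrm g}_2(R)$ is the subgroup generated by all translations and $\mathrm{Add}_2(R)$. $\mathrm{Aff}^{\mathrm d}_2(R)=\{\phi\in\mathrm{Aut}_R R[x_1,x_2]\mid J\phi\in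 \mathrm{GL}_2(R)\}$, where $J\phi$ is the Jacobian matrix of $\phi$ (i.e. all partial derivatives of $\phi(x_1),\phi(x_2)$ are constants in $R$). Finally $\mathrm{T}^{\mathrm g}_2(R)=\langle \mathrm{Aff}^{\mathrm g}_2(R),\mathrm{T}_2(R)\rangle$ and $\mathrm{T}^{\mathrm d}_2(R)=\langle \mathrm{Aff}^{\mathrm d}_2(R),\mathrm{T}_2(R)\rangle$. *)

theory Defs
  imports
    "HOL-Analysis.Cartesian_Space"
    "HOL-Computational_Algebra.Polynomial"
    "HOL-Algebra.Generated_Groups"
begin

text \<open>
  The coefficient domain R is a type \<open>'a :: idom\<close>, and \<open>R[x\<^sub>1, x\<^sub>2]\<close> is the type
  \<open>'a poly poly\<close>, read as \<open>R[x\<^sub>1][x\<^sub>2]\<close>: the inner variable is \<open>x\<^sub>1\<close>, the outer one \<open>x\<^sub>2\<close>.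
  Indices are taken from the two-element type \<open>2\<close>, whose elements are 1 and 2
  (in it, 2 = 0).
\<close>

definition const2 :: "'a::zero \<Rightarrow> 'a poly poly"
  where "const2 c = [:[:c:]:]"

definition var :: "2 \<Rightarrow> 'a::comm_semiring_1 poly poly"
  where "var i = (if i = 1 then [:[:0, 1:]:] else [:0, 1:])"

definition partial_deriv :: "2 \<Rightarrow> 'a::idom poly poly \<Rightarrow> 'a poly poly"
  where "partial_deriv i f = (if i = 1 then map_poly pderiv f else pderiv f)"

text \<open>
  Substitution of \<open>u i\<close> for \<open>x\<^sub>i\<close>, where \<open>\<iota>\<close> is the structure map of an R-algebra \<open>'b\<close>.
\<close>

definition subst2 :: "('a::zero \<Rightarrow> 'b::comm_semiring_1) \<Rightarrow> (2 \<Rightarrow> 'b) \<Rightarrow> 'a poly poly \<Rightarrow> 'b"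
  where "subst2 \<iota> u f = poly (map_poly (\<lambda>c. poly (map_poly \<iota> c) (u 1)) f) (u 2)"


type_synonym 'a endo2 = "'a poly poly \<Rightarrow> 'a poly poly"

definition alg_automorphism :: "'a::idom endo2 \<Rightarrow> bool"
  where "alg_automorphism \<phi> \<longleftrightarrow>
    bij \<phi> \<and>
    (\<forall>f g. \<phi> (f + g) = \<phi> f + \<phi> g) \<and>
    (\<forall>f g. \<phi> (f * g) = \<phi> f * \<phi> g) \<and>
    (\<forall>c. \<phi> (const2 c) = const2 c)"

definition Aut2 :: "('a::idom endo2) monoid"
  where "Aut2 = \<lparr>carrier = {\<phi>. alg_automorphism \<phi>}, mult = (\<circ>), one = id\<rparr>"

lemma group_Aut2: "group (Aut2 :: ('a::idom endo2) monoid)"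
proof (rule groupI)
  fix \<phi> \<psi> :: "'a endo2"
  assume "\<phi> \<in> carrier Aut2" "\<psi> \<in> carrier Aut2"
  then show "\<phi> \<otimes>\<^bsub>Aut2\<^esub> \<psi> \<in> carrier Aut2"
    by (auto simp: Aut2_def alg_automorphism_def intro: bij_comp)
next
  fix \<phi> :: "'a endo2"
  assume "\<phi> \<in> carrier Aut2"
  then have *: "alg_automorphism \<phi>" by (simp add: Aut2_def)
  then have b: "bij \<phi>" by (simp add: alg_automorphism_def)
  have i: "inv_into UNIV \<phi> (\<phi> f) = f" "\<phi> (inv_into UNIV \<phi> f) = f" for f
    using b by (simp_all add: bij_is_inj bij_is_surj surj_f_inv_f)
  have "alg_automorphism (inv_into UNIV \<phi>)"
    unfolding alg_automorphism_def
  proof (intro conjI allI)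
    show "bij (inv_into UNIV \<phi>)" using b by (rule bij_imp_bij_inv)
    show "inv_into UNIV \<phi> (f + g) = inv_into UNIV \<phi> f + inv_into UNIV \<phi> g" for f g
      using * i unfolding alg_automorphism_def by metis
    show "inv_into UNIV \<phi> (f * g) = inv_into UNIV \<phi> f * inv_into UNIV \<phi> g" for f g
      using * i unfolding alg_automorphism_def by metis
    show "inv_into UNIV \<phi> (const2 c) = const2 c" for c
      using * i unfolding alg_automorphism_def by metis
  qed
  moreover have "inv_into UNIV \<phi> \<circ> \<phi> = id"
    using i by auto
  ultimately show "\<exists>\<psi>\<in>carrier Aut2. \<psi> \<otimes>\<^bsub>Aut2\<^esub> \<phi> = \<one>\<^bsub>Aut2\<^esub>"
    by (auto simp: Aut2_def)
qed (auto simp: Aut2_def alg_automorphism_def)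


text \<open>Here and below, \<open>\<chi> j. \<phi> (var j)\<close> is the pair \<open>(\<phi>(x\<^sub>1), \<phi>(x\<^sub>2))\<close>.\<close>

definition Aff2 :: "'a::idom endo2 set"
  where "Aff2 = {\<phi> \<in> carrier Aut2. \<exists>(M :: 'a^2^2) (b :: 'a^2). invertible M \<and>
    (\<chi> j. \<phi> (var j)) = (\<chi> i. var i) v* map_matrix const2 M + (\<chi> j. const2 (b $ j))}"

definition Transl2 :: "'a::idom endo2 set"
  where "Transl2 = {\<phi> \<in> carrier Aut2. \<exists>b :: 'a^2.
    (\<chi> j. \<phi> (var j)) = (\<chi> i. var i) v* map_matrix const2 (mat 1) + (\<chi> j. const2 (b $ j))}"

text \<open>
  \<open>poly (map_poly const2 p) (var m)\<close> is the polynomial \<open>p(x\<^sub>m)\<close>, for a univariate \<open>p\<close>.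
\<close>

definition elementary :: "'a::idom endo2 \<Rightarrow> bool"
  where "elementary \<phi> \<longleftrightarrow> \<phi> \<in> carrier Aut2 \<and>
    (\<exists>(l :: 2) (m :: 2) (a :: 'a) (p :: 'a poly). l \<noteq> m \<and> a dvd 1 \<and>
      \<phi> (var l) = const2 a * var l + poly (map_poly const2 p) (var m) \<and>
      \<phi> (var m) = var m)"

definition E2 :: "'a::idom endo2 set"
  where "E2 = generate Aut2 {\<phi>. elementary \<phi>}"

definition T2 :: "'a::idom endo2 set"
  where "T2 = generate Aut2 (Aff2 \<union> E2)"

text \<open>
  The identity is stated in \<open>R[y\<^sub>1, y\<^sub>2][z\<^sub>1, z\<^sub>2]\<close>, with \<open>y\<^sub>i = const2 (var i)\<close>
  and \<open>z\<^sub>i = var i\<close>.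
\<close>

definition additive_poly :: "'a::idom poly poly \<Rightarrow> bool"
  where "additive_poly f \<longleftrightarrow>
    (let \<iota> = (\<lambda>c. const2 (const2 c)) :: 'a \<Rightarrow> 'a poly poly poly poly;
         y = (\<lambda>i. const2 (var i));
         z = (\<lambda>i. var i)
     in subst2 \<iota> (\<lambda>i. y i + z i) f = subst2 \<iota> y f + subst2 \<iota> z f)"

definition Add2 :: "'a::idom endo2 set"
  where "Add2 = {\<phi> \<in> carrier Aut2. additive_poly (\<phi> (var 1)) \<and> additive_poly (\<phi> (var 2))}"

definition Affg2 :: "'a::idom endo2 set"
  where "Affg2 = generate Aut2 (Transl2 \<union> Add2)"

definition jacobian :: "'a::idom endo2 \<Rightarrow> 'a poly poly^2^2"
  where "jacobian \<phi> = (\<chi> i j. partial_deriv j (\<phi> (var i)))"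

definition Affd2 :: "'a::idom endo2 set"
  where "Affd2 = {\<phi> \<in> carrier Aut2. \<exists>M :: 'a^2^2. invertible M \<and> jacobian \<phi> = map_matrix const2 M}"

definition Tg2 :: "'a::idom endo2 set"
  where "Tg2 = generate Aut2 (Affg2 \<union> T2)"

definition Td2 :: "'a::idom endo2 set"
  where "Td2 = generate Aut2 (Affd2 \<union> T2)"

end

theory Submission
  imports Defs "HOL-Algebra.Exponent"
begin

text \<open>
  Up to affine maps, an elementary automorphism is a shear \<open>x\<^sub>2 \<mapsto> x\<^sub>2 + f(x\<^sub>1)\<close>. So each of the groups \<open>T2\<close>, \<open>Tg2\<close> and \<open>Td2\<close>
  is generated by shears and a subgroup that contains the affine maps and is harmless in some sense: the affine maps
  themselves, the maps that are additive up to constants, and the maps with constant Jacobian matrix. The first two cases are treated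
  together, because additive polynomials in characteristic \<open>p\<close> are linear combinations of the monomials \<open>x\<^sub>i ^ (p ^ k)\<close> and behave
  like linear ones over the twisted ring of linearized polynomials.

  Words in these generators are controlled by a ping-pong argument. For the pair \<open>(\<phi>(x\<^sub>1), \<phi>(x\<^sub>2))\<close> of a word \<open>\<phi>\<close>, a shear with
  nonlinear \<open>f\<close> makes the second entry dominate the first one, in the sense of \<open>detached\<close> (lemma \<open>detached_shear\<close>, which
  rests on the Ore condition for linearized polynomials), and a harmless map destroys this, unless it is triangular
  (\<open>detached_triang\<close>). Hence the last shear of a word can be read off from the pair, and its nonlinear part has coefficients in \<open>R\<close>.
  For \<open>Td2\<close> the chain rule replaces the pair by the first column of the Jacobian matrix, on which shears act as elementary matrices
  and harmless maps as invertible constant matrices (\<open>ping_pong_columns\<close>).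

  The counterexamples come from the fraction field. Let \<open>a\<close> be a nonzero nonunit and \<open>\<tau>\<close> the shear with \<open>f = x\<^sub>1\<^sup>m / a\<close>. The conjugate
  by \<open>\<tau>\<close> of the linear map \<open>x\<^sub>1 \<mapsto> x\<^sub>1 + a\<^sup>2 x\<^sub>2\<close> has coefficients in \<open>R\<close>. Conjugating the shear \<open>x\<^sub>2 \<mapsto> x\<^sub>2 + x\<^sub>1\<close> by the resulting
  automorphism gives an automorphism \<open>\<phi>\<close> such that \<open>a \<phi>(x\<^sub>2) + \<phi>(x\<^sub>1)\<^sup>m\<close> has at most the degree of \<open>\<phi>(x\<^sub>1)\<close>, so its last shear is
  essentially \<open>- x\<^sub>1\<^sup>m / a\<close> and not defined over \<open>R\<close> (\<open>outside_generated\<close>, \<open>outside_Td2\<close>). For \<open>m = p\<close> the conjugating automorphism is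
  additive and refutes the normality of \<open>T2\<close> in \<open>Tg2\<close>; for \<open>m = p (p + 1)\<close> it has a constant Jacobian matrix and refutes that of \<open>Tg2\<close>
  in \<open>Td2\<close>; and \<open>m = p + 1\<close> serves for \<open>Td2\<close> in the full automorphism group. A group is normal in itself, so the groups differ.
\<close>

section \<open>Ring homomorphisms and substitution\<close>

definition is_hom :: "('a::comm_ring_1 \<Rightarrow> 'b::comm_ring_1) \<Rightarrow> bool"
  where "is_hom h \<longleftrightarrow> h 1 = 1 \<and> (\<forall>x y. h (x + y) = h x + h y) \<and> (\<forall>x y. h (x * y) = h x * h y)"

lemma is_homI:
  assumes "h 1 = 1" "\<And>x y. h (x + y) = h x + h y" "\<And>x y. h (x * y) = h x * h y"
  shows "is_hom h"
  using assms by (simp add: is_hom_def)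

lemma hom_simps:
  assumes "is_hom h"
  shows hom_one: "h 1 = 1" and hom_add: "h (x + y) = h x + h y" and hom_mult: "h (x * y) = h x * h y"
    and hom_zero: "h 0 = 0" and hom_minus: "h (- x) = - h x" and hom_diff: "h (x - y) = h x - h y"
    and hom_power: "h (x ^ n) = h x ^ n" and hom_sum: "h (sum g A) = (\<Sum>i\<in>A. h (g i))"
proof -
  show *: "h 1 = 1" "h (x + y) = h x + h y" "h (x * y) = h x * h y" for x y
    using assms by (simp_all add: is_hom_def)
  show 0: "h 0 = 0"
    using *(2)[of 0 0] by simp
  show m: "h (- x) = - h x" for x
    using *(2)[of "- x" x] 0 by (simp add: eq_neg_iff_add_eq_0)
  show "h (x - y) = h x - h y"
    using *(2)[of x "- y"] m by simp
  show "h (x ^ n) = h x ^ n"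
    by (induction n) (simp_all add: *)
  show "h (sum g A) = (\<Sum>i\<in>A. h (g i))"
    by (induction A rule: infinite_finite_induct) (simp_all add: * 0)
qed

lemma is_hom_comp: "is_hom g \<Longrightarrow> is_hom h \<Longrightarrow> is_hom (\<lambda>x. g (h x))"
  by (simp add: is_hom_def)

lemma is_hom_poly: "is_hom (\<lambda>p. poly p x)"
  by (simp add: is_hom_def)

lemma is_hom_id: "is_hom (\<lambda>x. x)"
  by (simp add: is_hom_def)

lemma is_hom_eval_map:
  assumes "is_hom \<iota>"
  shows "is_hom (\<lambda>p. poly (map_poly \<iota> p) x)"
proof (rule is_homI)
  note [simp] = hom_simps[OF assms]
  have pc: "poly (map_poly \<iota> (pCons a p)) x = \<iota> a + x * poly (map_poly \<iota> p) x" for a p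
    by (simp add: map_poly_pCons)
  show "poly (map_poly \<iota> 1) x = 1"
    by simp
  show add: "poly (map_poly \<iota> (p + q)) x = poly (map_poly \<iota> p) x + poly (map_poly \<iota> q) x" for p q
    by (induction p q rule: poly_induct2) (simp_all add: pc algebra_simps)
  have sm: "poly (map_poly \<iota> (smult c q)) x = \<iota> c * poly (map_poly \<iota> q) x" for c q
    by (induction q) (simp_all add: pc algebra_simps)
  show "poly (map_poly \<iota> (p * q)) x = poly (map_poly \<iota> p) x * poly (map_poly \<iota> q) x" for p q
    by (induction p) (simp_all add: pc add sm algebra_simps)
qed

lemma is_hom_subst2:
  assumes "is_hom \<iota>"
  shows "is_hom (subst2 \<iota> u)"
  unfolding subst2_def[abs_def] by (intro is_hom_eval_map assms)

lemma subst2_const2 [simp]: "\<iota> 0 = 0 \<Longrightarrow> subst2 \<iota> u (const2 c) = \<iota> c"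
  by (simp add: subst2_def const2_def map_poly_pCons)

lemma subst2_var [simp]:
  assumes "is_hom \<iota>"
  shows "subst2 \<iota> u (var i) = u i"
  using exhaust_2[of i] hom_simps[OF assms]
  by (auto simp: subst2_def var_def map_poly_pCons)

lemma is_hom_const2: "is_hom const2"
  by (auto simp: is_hom_def const2_def one_pCons)

lemmas const2_simps = hom_simps[OF is_hom_const2]

lemma const2_inject [simp]: "const2 a = const2 b \<longleftrightarrow> a = b"
  by (simp add: const2_def)

lemma const2_eq_0_iff [simp]: "const2 a = 0 \<longleftrightarrow> a = 0"
  by (simp add: const2_def)

lemma is_hom_const2_const2: "is_hom (\<lambda>c. const2 (const2 c))"
  by (rule is_hom_comp[OF is_hom_const2 is_hom_const2])

text \<open>Induction over the polynomial ring as an algebra generated by its two variables.\<close>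

lemma poly2_induct [case_names const var add mult]:
  fixes f :: "'a::comm_ring_1 poly poly"
  assumes const: "\<And>c. P (const2 c)" and var: "\<And>i. P (var i)"
    and add: "\<And>f g. P f \<Longrightarrow> P g \<Longrightarrow> P (f + g)" and mult: "\<And>f g. P f \<Longrightarrow> P g \<Longrightarrow> P (f * g)"
  shows "P f"
proof (induction f)
  case 0
  show ?case using const[of 0] by (simp add: const2_def)
next
  case (pCons q f)
  have q: "P [:q:]"
  proof (induction q)
    case 0
    show ?case using const[of 0] by (simp add: const2_def)
  next
    case (pCons c q)
    have "[:pCons c q:] = const2 c + var 1 * [:q:]"
      by (simp add: const2_def var_def)
    with pCons const var add mult show ?case by metis
  qed
  have "pCons q f = [:q:] + var 2 * f"
    by (simp add: var_def)
  with q pCons var add mult show ?case by metis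
qed

lemma hom_eqI:
  fixes g h :: "'a::comm_ring_1 poly poly \<Rightarrow> 'b::comm_ring_1"
  assumes "is_hom g" "is_hom h" "\<And>c. g (const2 c) = h (const2 c)" "g (var 1) = h (var 1)" "g (var 2) = h (var 2)"
  shows "g f = h f"
proof (induction f rule: poly2_induct)
  case (var i)
  show ?case using exhaust_2[of i] assms(4,5) by auto
qed (use assms in \<open>simp_all add: is_hom_def\<close>)

lemma hom_subst2:
  assumes "is_hom h" "is_hom \<iota>"
  shows "h (subst2 \<iota> u f) = subst2 (\<lambda>c. h (\<iota> c)) (\<lambda>i. h (u i)) f"
proof -
  note [simp] = hom_simps[OF assms(1)] hom_simps[OF assms(2)]
  show ?thesis
  proof (rule hom_eqI[where g = "\<lambda>f. h (subst2 \<iota> u f)" and h = "subst2 (\<lambda>c. h (\<iota> c)) (\<lambda>i. h (u i))"])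
    show "is_hom (\<lambda>f. h (subst2 \<iota> u f))" "is_hom (subst2 (\<lambda>c. h (\<iota> c)) (\<lambda>i. h (u i)))"
      by (rule is_hom_comp[OF assms(1) is_hom_subst2[OF assms(2)]] is_hom_subst2[OF is_hom_comp[OF assms]])+
  qed (simp_all add: is_hom_comp assms)
qed

text \<open>
  For \<open>F = var m\<close> this is the term that occurs in the definition of elementary automorphisms.
\<close>

definition ev :: "'a::comm_ring_1 poly \<Rightarrow> 'a poly poly \<Rightarrow> 'a poly poly"
  where "ev p F = poly (map_poly const2 p) F"

lemma is_hom_ev: "is_hom (\<lambda>p. ev p F)"
  unfolding ev_def by (rule is_hom_eval_map[OF is_hom_const2])

lemmas ev_simps [simp] = hom_simps[OF is_hom_ev]

lemma ev_pCons: "ev (pCons c p) F = const2 c + F * ev p F"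
  by (simp add: ev_def map_poly_pCons const2_simps)

lemma ev_const [simp]: "ev [:c:] F = const2 c"
  by (simp add: ev_pCons)

lemma ev_X [simp]: "ev [:0, 1:] F = F"
  by (simp add: ev_pCons const2_simps)

lemma ev_smult: "ev (smult c p) F = const2 c * ev p F"
  by (induction p) (simp_all add: ev_pCons const2_simps algebra_simps)

lemma ev_monom: "ev (monom c n) F = const2 c * F ^ n"
  by (induction n) (simp_all add: monom_0 monom_Suc ev_pCons const2_simps mult_ac)

lemma ev_pcompose: "ev (pcompose p q) F = ev p (ev q F)"
  by (induction p) (simp_all add: pcompose_pCons ev_pCons)

lemma hom_ev:
  assumes "is_hom h" "\<And>c. h (const2 c) = const2 c"
  shows "h (ev p F) = ev p (h F)"
proof -
  note [simp] = hom_simps[OF assms(1)]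
  show ?thesis
    by (induction p) (simp_all add: ev_pCons assms)
qed

section \<open>Total degree\<close>

text \<open>
  The total degree is read off as the degree in a fresh variable \<open>t\<close> of \<open>f(x\<^sub>1 t, x\<^sub>2 t)\<close>.
  As this substitution is a ring homomorphism into polynomials over a domain, the degree
  rules for products and sums are inherited from univariate polynomials.
\<close>

definition homog :: "'a::comm_ring_1 poly poly \<Rightarrow> 'a poly poly poly"
  where "homog = subst2 (\<lambda>c. [:const2 c:]) (\<lambda>i. [:0, var i:])"

definition tdeg :: "'a::comm_ring_1 poly poly \<Rightarrow> nat"
  where "tdeg f = degree (homog f)"

lemma is_hom_pconst: "is_hom (\<lambda>c. [:c:])"
  by (auto simp: is_hom_def one_pCons)

lemma is_hom_homog_const: "is_hom (\<lambda>c. [:const2 c:])"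
  by (rule is_hom_comp[OF is_hom_pconst is_hom_const2])

lemma is_hom_homog: "is_hom homog"
  unfolding homog_def by (intro is_hom_subst2 is_hom_homog_const)

lemmas homog_simps = hom_simps[OF is_hom_homog]

lemma homog_const2 [simp]: "homog (const2 c) = [:const2 c:]"
  by (simp add: homog_def const2_simps)

lemma homog_var [simp]: "homog (var i) = [:0, var i:]"
  by (simp add: homog_def is_hom_homog_const)

lemma poly_homog_1: "poly (homog f) 1 = f"
proof (rule hom_eqI[where g = "\<lambda>f. poly (homog f) 1" and h = "\<lambda>f. f"])
  show "is_hom (\<lambda>f. poly (homog f) 1)"
    by (rule is_hom_comp[OF is_hom_poly is_hom_homog])
qed (simp_all add: is_hom_id)

lemma poly_homog_0: "\<exists>c. poly (homog f) 0 = const2 c"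
proof -
  have "poly (homog f) 0 = const2 (subst2 (\<lambda>c. c) (\<lambda>i. 0) f)"
  proof (rule hom_eqI[where g = "\<lambda>f. poly (homog f) 0" and h = "\<lambda>f. const2 (subst2 (\<lambda>c. c) (\<lambda>i. 0) f)"])
    show "is_hom (\<lambda>f. poly (homog f) 0)"
      by (rule is_hom_comp[OF is_hom_poly is_hom_homog])
    show "is_hom (\<lambda>f. const2 (subst2 (\<lambda>c. c) (\<lambda>i. 0) f))"
      by (rule is_hom_comp[OF is_hom_const2 is_hom_subst2[OF is_hom_id]])
  qed (simp_all add: is_hom_id const2_simps)
  then show ?thesis by blast
qed

lemma homog_eq_0_iff [simp]: "homog f = 0 \<longleftrightarrow> f = 0"
  using poly_homog_1[of f] by (auto simp: homog_simps)

text \<open>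
  The value at \<open>t = 1\<close> is \<open>f\<close> and the value at \<open>t = 0\<close> is its constant term; they agree if \<open>t\<close> does not occur.
\<close>

lemma tdeg_eq_0_iff: "tdeg f = 0 \<longleftrightarrow> (\<exists>c. f = const2 c)"
proof
  assume "tdeg f = 0"
  then obtain g where g: "homog f = [:g:]"
    unfolding tdeg_def by (meson degree_eq_zeroE)
  obtain c where "poly (homog f) 0 = const2 c"
    using poly_homog_0 by blast
  with g poly_homog_1[of f] show "\<exists>c. f = const2 c"
    by auto
qed (auto simp: tdeg_def)

lemma tdeg_const2 [simp]: "tdeg (const2 c) = 0"
  by (simp add: tdeg_def)

lemma tdeg_0 [simp]: "tdeg 0 = 0"
  by (simp add: tdeg_def homog_simps)

lemma var_neq_0 [simp]: "var i \<noteq> (0 :: 'a::comm_ring_1 poly poly)"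
  by (simp add: var_def)

lemma tdeg_var [simp]: "tdeg (var i :: 'a::comm_ring_1 poly poly) = 1"
  by (simp add: tdeg_def)

lemma tdeg_mult: "f \<noteq> 0 \<Longrightarrow> g \<noteq> 0 \<Longrightarrow> tdeg (f * g) = tdeg f + tdeg (g :: 'a::idom poly poly)"
  by (simp add: tdeg_def homog_simps degree_mult_eq)

lemma tdeg_const_mult [simp]: "c \<noteq> 0 \<Longrightarrow> tdeg (const2 c * f) = tdeg (f :: 'a::idom poly poly)"
  by (cases "f = 0") (simp_all add: tdeg_mult)

lemma tdeg_const_mult_le: "tdeg (const2 c * f) \<le> tdeg (f :: 'a::idom poly poly)"
  by (cases "c = 0") (simp_all add: const2_simps)

lemma tdeg_minus [simp]: "tdeg (- f) = tdeg f"
  by (simp add: tdeg_def homog_simps)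

lemma tdeg_add_le: "tdeg f \<le> n \<Longrightarrow> tdeg g \<le> n \<Longrightarrow> tdeg (f + g) \<le> n"
  by (simp add: tdeg_def homog_simps degree_add_le)

lemma tdeg_diff_le: "tdeg f \<le> n \<Longrightarrow> tdeg g \<le> n \<Longrightarrow> tdeg (f - g) \<le> n"
  by (simp add: tdeg_def homog_simps degree_diff_le)

lemma tdeg_add_eq_right: "tdeg f < tdeg g \<Longrightarrow> tdeg (f + g) = tdeg g"
  by (simp add: tdeg_def homog_simps degree_add_eq_right)

lemma tdeg_add_eq_left: "tdeg g < tdeg f \<Longrightarrow> tdeg (f + g) = tdeg f"
  by (simp add: tdeg_def homog_simps degree_add_eq_left)

lemma tdeg_add_const [simp]: "tdeg (f + const2 c) = tdeg f"
proof (cases "tdeg f = 0")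
  case True
  then obtain d where "f = const2 d" using tdeg_eq_0_iff by blast
  then have "f + const2 c = const2 (d + c)" by (simp add: const2_simps)
  then show ?thesis using True tdeg_const2 by metis
qed (simp add: tdeg_add_eq_left)

lemma homog_ev: "homog (ev p F) = pcompose (map_poly const2 p) (homog F)"
  by (induction p)
    (simp_all add: ev_pCons homog_simps map_poly_pCons const2_simps pcompose_pCons)

lemma tdeg_ev: "tdeg (ev p F) = degree p * tdeg (F :: 'a::idom poly poly)"
  by (simp add: tdeg_def homog_ev degree_pcompose degree_map_poly)

lemma tdeg_power: "tdeg (F ^ n) = n * tdeg (F :: 'a::idom poly poly)"
  using tdeg_ev[of "monom 1 n" F] by (simp add: ev_monom const2_simps degree_monom_eq)

section \<open>Linearized polynomials\<close>

text \<open>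
  In characteristic \<open>p\<close> the polynomials supported on powers of \<open>p\<close> act as additive maps, just as
  the multiples of the variable do, which are the case \<open>s = 1\<close>. Under composition both kinds form a
  domain, commutative for \<open>s = 1\<close> and a twisted polynomial ring for \<open>s = p\<close>. Up to
  translations, affine and additive automorphisms are matrices over these rings.
\<close>

definition linearized :: "nat \<Rightarrow> 'a::zero poly \<Rightarrow> bool"
  where "linearized s p \<longleftrightarrow> (\<forall>n. coeff p n \<noteq> 0 \<longrightarrow> n \<in> range ((^) s))"

text \<open>
  Constant terms do not count: they belong to translations, not to the nonlinear part.
\<close>

definition nonlinearized :: "nat \<Rightarrow> 'a::zero poly \<Rightarrow> bool"
  where "nonlinearized s p \<longleftrightarrow> (\<exists>n>0. n \<notin> range ((^) s) \<and> coeff p n \<noteq> 0)"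

lemma linearized_0 [simp]: "linearized s 0"
  by (simp add: linearized_def)

lemma linearized_add: "linearized s p \<Longrightarrow> linearized s q \<Longrightarrow> linearized s (p + q)"
  unfolding linearized_def by (metis add.right_neutral coeff_add)

lemma linearized_diff:
  "linearized s p \<Longrightarrow> linearized s q \<Longrightarrow> linearized s (p - q :: 'a::ab_group_add poly)"
  unfolding linearized_def by (metis diff_0_right coeff_diff)

lemma linearized_smult: "linearized s p \<Longrightarrow> linearized s (smult c p)"
  unfolding linearized_def by (metis coeff_smult mult_zero_right)

lemma linearized_sum: "(\<And>i. i \<in> A \<Longrightarrow> linearized s (f i)) \<Longrightarrow> linearized s (sum f A)"
  by (induction A rule: infinite_finite_induct) (simp_all add: linearized_add)

lemma linearized_monom: "linearized s (monom c (s ^ k))"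
  by (auto simp: linearized_def)

lemma linearized_scale: "linearized s [:0, c:]"
  using linearized_monom[of s c 0] by (simp add: monom_Suc monom_0)

lemma linearized_degree:
  assumes "linearized s p" "p \<noteq> 0"
  obtains k where "degree p = s ^ k"
  using assms unfolding linearized_def by (metis leading_coeff_0_iff image_iff)

text \<open>
  The case \<open>s = 1\<close> will govern \<open>T2\<close> and the case \<open>s = p\<close> will govern \<open>Tg2\<close>.
  Both rest on the same fact, the additivity of the power maps \<open>x \<mapsto> x ^ (s ^ k)\<close>.
\<close>

locale frobenius_power =
  fixes s :: nat and R :: "'a::idom itself"
  assumes frob: "s = 1 \<or> prime s \<and> s = CHAR('a)"
begin

lemma s_pos: "s > 0"
  using frob prime_gt_0_nat by auto

lemma linearized_degree_pos: "linearized s p \<Longrightarrow> p \<noteq> 0 \<Longrightarrow> degree p > 0"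
  by (metis linearized_degree s_pos zero_less_power)

lemma frob_add:
  fixes x y :: "'b::comm_ring_1"
  assumes "CHAR('b) = CHAR('a)"
  shows "(x + y) ^ (s ^ k) = x ^ (s ^ k) + y ^ (s ^ k)"
  using frob freshmans_dream'[where ?'a = 'b, of "s ^ k" k x y] assms by auto

lemma frob_sum:
  fixes f :: "'c \<Rightarrow> 'b::comm_ring_1"
  assumes "CHAR('b) = CHAR('a)"
  shows "(\<Sum>i\<in>A. f i) ^ (s ^ k) = (\<Sum>i\<in>A. f i ^ (s ^ k))"
  by (induction A rule: infinite_finite_induct) (simp_all add: frob_add[OF assms] s_pos power_0_left)

lemma poly_linearized_add:
  fixes p :: "'b::comm_ring_1 poly"
  assumes "CHAR('b) = CHAR('a)" "linearized s p"
  shows "poly p (x + y) = poly p x + poly p y"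
proof -
  have "coeff p n * (x + y) ^ n = coeff p n * x ^ n + coeff p n * y ^ n" for n
  proof (cases "coeff p n = 0")
    case False
    then obtain k where "n = s ^ k" using assms(2) by (auto simp: linearized_def)
    then show ?thesis by (simp add: frob_add[OF assms(1)] algebra_simps)
  qed simp
  then show ?thesis by (simp add: poly_altdef sum.distrib)
qed

lemma linearized_map_poly:
  "f 0 = 0 \<Longrightarrow> linearized s p \<Longrightarrow> linearized s (map_poly f p)"
  unfolding linearized_def by (metis coeff_map_poly)

lemma ev_linearized_add:
  fixes F G :: "'a poly poly"
  assumes "linearized s p"
  shows "ev p (F + G) = ev p F + ev p G"
  unfolding ev_def
  by (rule poly_linearized_add) (simp_all add: linearized_map_poly assms const2_simps)

lemma pcompose_linearized_add:
  fixes p q r :: "'a poly"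
  assumes "linearized s p"
  shows "pcompose p (q + r) = pcompose p q + pcompose p r"
  unfolding pcompose_altdef
  by (rule poly_linearized_add) (simp_all add: linearized_map_poly assms)

lemma linearized_power:
  fixes p :: "'a poly"
  assumes "linearized s p"
  shows "linearized s (p ^ (s ^ k))"
proof -
  have "p ^ (s ^ k) = (\<Sum>i\<le>degree p. monom (coeff p i) i ^ (s ^ k))"
    by (subst poly_as_sum_of_monoms[symmetric]) (simp add: frob_sum)
  also have "linearized s \<dots>"
  proof (rule linearized_sum)
    fix i
    show "linearized s (monom (coeff p i) i ^ (s ^ k))"
    proof (cases "coeff p i = 0")
      case True
      then show ?thesis using s_pos by (simp add: power_0_left)
    next
      case False
      then obtain j where "i = s ^ j" using assms by (auto simp: linearized_def)
      then show ?thesis by (simp add: monom_power linearized_monom flip: power_add)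
    qed
  qed
  finally show ?thesis .
qed

lemma pcompose_monom: "pcompose (monom c n) p = smult c (p ^ n)"
  by (induction n) (simp_all add: monom_0 monom_Suc pcompose_pCons)

lemma linearized_pcompose:
  fixes p q :: "'a poly"
  assumes "linearized s p" "linearized s q"
  shows "linearized s (pcompose p q)"
proof -
  have "pcompose p q = (\<Sum>i\<le>degree p. smult (coeff p i) (q ^ i))"
    by (subst (1) poly_as_sum_of_monoms[symmetric]) (simp add: pcompose_sum pcompose_monom)
  also have "linearized s \<dots>"
  proof (rule linearized_sum)
    fix i
    show "linearized s (smult (coeff p i) (q ^ i))"
      using assms linearized_power[OF assms(2)]
      by (cases "coeff p i = 0") (auto simp: linearized_def[of s p] linearized_smult)
  qed
  finally show ?thesis .
qed

lemma pcompose_linearized_neq_0: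
  fixes p q :: "'a poly"
  assumes "linearized s q" "p \<noteq> 0" "q \<noteq> 0"
  shows "pcompose p q \<noteq> 0"
  using assms linearized_degree_pos[of q] pcompose_eq_0 by blast

text \<open>
  Linearized polynomials over the fraction field admit division with remainder, hence common left
  multiples. To stay over the domain, the division step cancels the leading terms of \<open>l u\<close>
  and \<open>e \<circ> v\<close>, where \<open>l\<close> is the appropriate power of the leading coefficient of \<open>v\<close>; the induction
  is on the sum of the degrees.
\<close>

lemma left_ore_condition:
  fixes p q :: "'a poly"
  assumes "linearized s p" "p \<noteq> 0" "linearized s q" "q \<noteq> 0"
  shows "\<exists>c d. linearized s c \<and> c \<noteq> 0 \<and> linearized s d \<and> d \<noteq> 0 \<and> pcompose c p = pcompose d q"
  using assms
proof (induction "degree p + degree q" arbitrary: p q rule: less_induct)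
  case less
  define Ore :: "'a poly \<Rightarrow> 'a poly \<Rightarrow> bool" where "Ore p q \<longleftrightarrow>
    (\<exists>c d. linearized s c \<and> c \<noteq> 0 \<and> linearized s d \<and> d \<noteq> 0 \<and> pcompose c p = pcompose d q)" for p q
  have step: "Ore u v"
    if uv: "linearized s u" "u \<noteq> 0" "linearized s v" "v \<noteq> 0"
      and le: "degree v \<le> degree u" and sum: "degree u + degree v = degree p + degree q" for u v
  proof -
    obtain k where k: "degree u = s ^ k * degree v"
    proof -
      obtain i j where ij: "degree u = s ^ i" "degree v = s ^ j"
        using linearized_degree uv by metis
      show ?thesis
      proof (cases "s = 1")
        case True
        then show ?thesis using ij that[of 0] by simp
      next
        case False
        with s_pos le ij have "j \<le> i"
          by (metis One_nat_def Suc_lessI power_increasing_iff)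
        then show ?thesis using ij that[of "i - j"] by (simp flip: power_add)
      qed
    qed
    define l where "l = lead_coeff v ^ (s ^ k)"
    define e where "e = monom (lead_coeff u) (s ^ k)"
    have l: "l \<noteq> 0" using uv by (simp add: l_def)
    have e: "linearized s e" "e \<noteq> 0" using uv by (simp_all add: e_def linearized_monom)
    define r where "r = smult l u - pcompose e v"
    have lin_r: "linearized s r"
      unfolding r_def by (intro linearized_diff linearized_smult linearized_pcompose uv e)
    have scale: "pcompose [:0, l:] u = smult l u"
      by (simp add: pcompose_pCons)
    show ?thesis
    proof (cases "r = 0")
      case True
      then show ?thesis
        unfolding Ore_def using e l scale linearized_scale
        by (intro exI[of _ "[:0, l:]"] exI[of _ e]) (simp add: r_def)
    next
      case False
      have dr: "degree (pcompose e v) = degree u"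
      proof -
        have "degree e = s ^ k"
          using uv by (simp add: e_def degree_monom_eq)
        then show ?thesis by (simp add: degree_pcompose k)
      qed
      have pe: "pcompose e v = smult (lead_coeff u) (v ^ (s ^ k))"
        by (simp add: e_def pcompose_monom)
      have "coeff (pcompose e v) (degree u) = lead_coeff (pcompose e v)"
        by (simp only: dr)
      also have "\<dots> = l * lead_coeff u"
        by (simp only: pe lead_coeff_smult lead_coeff_power l_def mult.commute)
      finally have "coeff r (degree u) = 0"
        by (simp add: r_def)
      moreover have "degree r \<le> degree u"
        unfolding r_def using dr by (intro degree_diff_le) auto
      ultimately have "degree r < degree u"
        using False by (metis le_neq_implies_less leading_coeff_0_iff)
      with less.hyps[of r v] sum lin_r False uv obtain c d where
        cd: "linearized s c" "c \<noteq> 0" "linearized s d" "d \<noteq> 0" "pcompose c r = pcompose d v"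
        by (metis add_strict_right_mono)
      define c' where "c' = pcompose c [:0, l:]"
      define d' where "d' = d + pcompose c e"
      have lin: "linearized s c'" "linearized s d'"
        by (simp_all add: c'_def d'_def linearized_pcompose linearized_add linearized_scale cd e)
      have "smult l u = r + pcompose e v" by (simp add: r_def)
      then have eq: "pcompose c' u = pcompose d' v"
        by (simp add: c'_def d'_def scale pcompose_linearized_add cd pcompose_add flip: pcompose_assoc)
      have "c' \<noteq> 0"
        unfolding c'_def using l cd by (intro pcompose_linearized_neq_0 linearized_scale) auto
      moreover from this have "d' \<noteq> 0"
        using eq pcompose_linearized_neq_0[OF uv(1) _ uv(2), of c'] by auto
      ultimately show ?thesis
        unfolding Ore_def using lin eq by blast
    qed
  qed
  show ?case
  proof (cases "degree q \<le> degree p")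
    case True
    then show ?thesis using step[of p q] less.prems by (simp add: Ore_def)
  next
    case False
    then have "Ore q p" using step[of q p] less.prems by simp
    then show ?thesis unfolding Ore_def by metis
  qed
qed

text \<open>
  Write \<open>f\<close> as its nonlinear part \<open>g\<close> plus a linearized part plus a constant. As \<open>e\<close> is additive, it acts on
  the three separately. The top exponent of \<open>e(g)\<close> is \<open>degree e * degree g\<close>, where \<open>degree e\<close> is a power of \<open>s\<close> and
  \<open>degree g\<close> is not; so the linearized image of the second part cannot cancel it.
\<close>

lemma nonlinearized_pcompose:
  fixes e f :: "'a poly"
  assumes "linearized s e" "e \<noteq> 0" "nonlinearized s f"
  obtains N where "coeff (pcompose e f) N \<noteq> 0" "N \<notin> range ((^) s)" "N \<ge> 2 * degree e"
proof -
  define A where "A = {n. n \<le> degree f \<and> 0 < n \<and> n \<notin> range ((^) s)}"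
  define g where "g = (\<Sum>n\<in>A. monom (coeff f n) n)"
  have [simp]: "finite A" by (simp add: A_def)
  have g: "coeff g n = (if n \<in> A then coeff f n else 0)" for n
    by (simp add: g_def coeff_sum sum.delta if_distrib cong: if_cong)
  have "g \<noteq> 0"
    using assms(3) g le_degree unfolding nonlinearized_def A_def by (metis (mono_tags, lifting) coeff_0 mem_Collect_eq)
  then have "degree g \<in> A"
    by (metis g leading_coeff_0_iff)
  then have dg: "degree g > 0" "degree g \<notin> range ((^) s)"
    by (auto simp: A_def)
  define h where "h = f - g - [:coeff f 0:]"
  have h: "linearized s h"
    unfolding linearized_def
  proof (intro allI impI)
    fix n
    assume *: "coeff h n \<noteq> 0"
    then have n: "n > 0" "coeff f n \<noteq> coeff g n"
      by (cases n; simp add: h_def g A_def)+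
    then have "n \<notin> A" by (auto simp: g)
    moreover have "coeff f n \<noteq> 0" using n by (auto simp: g split: if_splits)
    ultimately show "n \<in> range ((^) s)"
      using n(1) le_degree[of f n] by (auto simp: A_def)
  qed
  have eq: "pcompose e f = pcompose e g + pcompose e h + [:poly e (coeff f 0):]"
  proof -
    have "f = (g + h) + [:coeff f 0:]" by (simp add: h_def)
    then have "pcompose e f = pcompose e g + pcompose e h + pcompose e [:coeff f 0:]"
      using pcompose_linearized_add[OF assms(1)] by metis
    then show ?thesis by (simp add: pcompose_pCons_0)
  qed
  define N where "N = degree e * degree g"
  obtain i where i: "degree e = s ^ i"
    using linearized_degree assms by blast
  have N: "N \<notin> range ((^) s)"
  proof
    assume "N \<in> range ((^) s)"
    then obtain j where j: "s ^ i * degree g = s ^ j" by (auto simp: N_def i)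
    show False
    proof (cases "s = 1")
      case True
      then have "degree g = s ^ 0" using j by simp
      then show ?thesis using dg by blast
    next
      case False
      then have s2: "s > 1" using s_pos by simp
      have "s ^ i \<le> s ^ j" using j dg by (metis dvd_imp_le dvd_triv_left s_pos zero_less_power)
      then have "i \<le> j" using s2 by simp
      then have "s ^ i * degree g = s ^ i * s ^ (j - i)" using j by (simp flip: power_add)
      then have "degree g = s ^ (j - i)" using s_pos by simp
      then show ?thesis using dg by blast
    qed
  qed
  have N0: "N > 0" using dg i s_pos by (simp add: N_def)
  have "degree g \<noteq> 1" using dg(2) by (metis power_0 rangeI)
  then have "degree g \<ge> 2" using dg by linarith
  then have "N \<ge> 2 * degree e" by (simp add: N_def)
  moreover have "coeff (pcompose e f) N \<noteq> 0"
  proof -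
    have "coeff (pcompose e h) N = 0"
      using linearized_pcompose[OF assms(1) h] N by (auto simp: linearized_def)
    moreover have "coeff (pcompose e g) N \<noteq> 0"
      unfolding N_def using dg assms(2) pcompose_eq_0[of e g]
      by (metis degree_pcompose leading_coeff_0_iff)
    ultimately show ?thesis
      using N0 by (cases N) (auto simp: eq)
  qed
  ultimately show ?thesis using that N by blast
qed

text \<open>
  The condition says that, among all combinations of \<open>F\<close> and \<open>G\<close> with linearized coefficients, those that involve
  \<open>G\<close> have larger degree than \<open>F\<close>. It refers to the whole module
  spanned by \<open>F\<close> and \<open>G\<close>, so it can be transported along a change of generators, which is how
  the additive automorphisms act. For \<open>s = 1\<close> it is \<open>tdeg F < tdeg G\<close>.
\<close>

definition detached :: "'a poly poly \<Rightarrow> 'a poly poly \<Rightarrow> bool"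
  where "detached F G \<longleftrightarrow>
    (\<forall>a b. linearized s a \<and> linearized s b \<and> b \<noteq> 0 \<longrightarrow> tdeg F < tdeg (ev a F + ev b G))"

text \<open>
  The step of the ping-pong in which a shear acts. If the conclusion failed, there would be
  a combination of low degree involving \<open>G\<close> and another one involving \<open>d G + f(F)\<close>. By the
  Ore condition suitable multiples of them eliminate \<open>G\<close> and leave \<open>u(F)\<close>, where \<open>u\<close> contains the nonlinear part
  of \<open>e(f)\<close> and therefore has degree at least \<open>2 degree e\<close>, while the two multipliers
  have degree at most \<open>degree e\<close>. The factor \<open>d\<close> permits shears with coefficients in the fraction field,
  with denominator \<open>d\<close>.
\<close>

lemma detached_shear:
  fixes F G :: "'a poly poly"
  assumes F: "tdeg F > 0" and nd: "\<not> detached F G" and d: "d \<noteq> 0" and f: "nonlinearized s f"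
  shows "detached F (const2 d * G + ev f F)"
proof (rule ccontr)
  assume "\<not> detached F (const2 d * G + ev f F)"
  then obtain a' b' where ab': "linearized s a'" "linearized s b'" "b' \<noteq> 0"
    and le': "tdeg (ev a' F + ev b' (const2 d * G + ev f F)) \<le> tdeg F"
    by (auto simp: detached_def not_less)
  obtain a b where ab: "linearized s a" "linearized s b" "b \<noteq> 0"
    and le: "tdeg (ev a F + ev b G) \<le> tdeg F"
    using nd by (auto simp: detached_def not_less)
  define b'' where "b'' = pcompose b' [:0, d:]"
  have b'': "linearized s b''" "b'' \<noteq> 0"
    using ab' d by (simp_all add: b''_def linearized_pcompose linearized_scale pcompose_linearized_neq_0)
  obtain c c' where c: "linearized s c" "c \<noteq> 0" "linearized s c'" "c' \<noteq> 0"
    and eq: "pcompose c b = pcompose c' b''"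
    using left_ore_condition[OF ab(2,3) b''] by blast
  define e where "e = pcompose c' b'"
  have e: "linearized s e" "e \<noteq> 0"
    using c ab' by (simp_all add: e_def linearized_pcompose pcompose_linearized_neq_0)
  have "degree c \<le> degree c * degree b"
    using linearized_degree_pos[OF ab(2,3)] by simp
  also have "\<dots> = degree e"
    using arg_cong[OF eq, of degree] d by (simp add: degree_pcompose b''_def e_def)
  finally have dc: "degree c \<le> degree e" .
  have dc': "degree c' \<le> degree e"
    using linearized_degree_pos[OF ab'(2,3)] by (simp add: e_def degree_pcompose)
  define u where "u = pcompose c a - pcompose c' a' - pcompose e f"
  obtain N where N: "coeff (pcompose e f) N \<noteq> 0" "N \<notin> range ((^) s)" "N \<ge> 2 * degree e"
    using nonlinearized_pcompose[OF e f] .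
  have "linearized s (pcompose c a - pcompose c' a')"
    by (intro linearized_diff linearized_pcompose c ab ab')
  then have "coeff (pcompose c a - pcompose c' a') N = 0"
    using N(2) by (auto simp: linearized_def)
  then have "coeff u N \<noteq> 0"
    using N(1) by (simp add: u_def)
  then have "2 * degree e \<le> degree u"
    using N(3) le_degree le_trans by blast
  moreover have "ev u F = ev c (ev a F + ev b G) - ev c' (ev a' F + ev b' (const2 d * G + ev f F))"
  proof -
    have "ev b' (const2 d * G) = ev b'' G"
      by (simp add: b''_def ev_pcompose ev_pCons const2_simps mult.commute)
    then show ?thesis
      using c ab ab' arg_cong[OF eq, of "\<lambda>p. ev p G"]
      by (simp add: u_def e_def ev_linearized_add ev_pcompose)
  qed
  then have "tdeg (ev u F) \<le> degree e * tdeg F"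
    using mult_le_mono[OF dc le] mult_le_mono[OF dc' le'] by (simp add: tdeg_diff_le tdeg_ev)
  ultimately have "2 * degree e * tdeg F \<le> degree e * tdeg F"
    by (metis (no_types) le_trans mult_le_mono1 tdeg_ev)
  moreover have "degree e > 0" using linearized_degree_pos e by blast
  ultimately show False using F by simp
qed

end

section \<open>The ping-pong principle\<close>

text \<open>
  Maps from \<open>A\<close> and \<open>B\<close> act alternately on \<open>Y\<close>, starting in the set \<open>X0\<close>. A map in \<open>B\<close> produces the property \<open>P\<close>
  from its negation, unless it acts like a map in \<open>A\<close>; a map in \<open>A\<close> destroys \<open>P\<close>, unless it lies in \<open>C\<close>, and then
  maps in \<open>B\<close> can be moved across it. So each word can be shortened until \<open>B\<close> acts properly at each of its occurrences, and for a
  point with property \<open>P\<close> the last letter from \<open>B\<close> can be recovered.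
\<close>

locale ping_pong =
  fixes Y X0 :: "'x set" and A B C :: "('x \<Rightarrow> 'x) set" and P :: "'x \<Rightarrow> bool"
  assumes base: "X0 \<subseteq> Y" "\<And>x. x \<in> X0 \<Longrightarrow> \<not> P x" "\<And>\<alpha>. \<alpha> \<in> A \<Longrightarrow> \<alpha> ` X0 \<subseteq> X0"
    and A_id: "id \<in> A"
    and A_comp: "\<And>\<alpha> \<alpha>'. \<alpha> \<in> A \<Longrightarrow> \<alpha>' \<in> A \<Longrightarrow> \<alpha> \<circ> \<alpha>' \<in> A"
    and B_comp: "\<And>\<beta> \<beta>'. \<beta> \<in> B \<Longrightarrow> \<beta>' \<in> B \<Longrightarrow> \<beta> \<circ> \<beta>' \<in> B"
    and A_Y: "\<And>\<alpha>. \<alpha> \<in> A \<Longrightarrow> \<alpha> ` Y \<subseteq> Y"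
    and B_Y: "\<And>\<beta>. \<beta> \<in> B \<Longrightarrow> \<beta> ` Y \<subseteq> Y"
    and ping: "\<And>x \<beta>. x \<in> Y \<Longrightarrow> \<beta> \<in> B \<Longrightarrow> \<not> P x \<Longrightarrow> P (\<beta> x) \<or> (\<exists>\<alpha>\<in>A. \<beta> x = \<alpha> x)"
    and pong: "\<And>x \<alpha>. x \<in> Y \<Longrightarrow> \<alpha> \<in> A \<Longrightarrow> P x \<Longrightarrow> P (\<alpha> x) \<Longrightarrow> \<alpha> \<in> C"
    and swap: "\<And>\<alpha> \<beta>. \<alpha> \<in> C \<Longrightarrow> \<beta> \<in> B \<Longrightarrow> \<exists>\<beta>'\<in>B. \<exists>\<alpha>'\<in>A. \<forall>x\<in>Y. (\<beta> \<circ> \<alpha>) x = (\<alpha>' \<circ> \<beta>') x"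
begin

text \<open>The images of \<open>X0\<close> under the shortened words.\<close>

inductive_set reach :: "'x set" where
  start: "x \<in> X0 \<Longrightarrow> x \<in> reach"
| step: "x \<in> reach \<Longrightarrow> \<not> P x \<Longrightarrow> \<beta> \<in> B \<Longrightarrow> P (\<beta> x) \<Longrightarrow> \<alpha> \<in> A \<Longrightarrow> \<alpha> (\<beta> x) \<in> reach"

lemma reach_Y: "x \<in> reach \<Longrightarrow> x \<in> Y"
proof (induction rule: reach.induct)
  case (start x)
  then show ?case using base(1) by blast
next
  case (step x \<beta> \<alpha>)
  then show ?case using A_Y[of \<alpha>] B_Y[of \<beta>] by blast
qed

lemma reach_A: "x \<in> reach \<Longrightarrow> \<alpha> \<in> A \<Longrightarrow> \<alpha> x \<in> reach"
proof (induction rule: reach.induct)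
  case (start x)
  then show ?case using base(3)[of \<alpha>] by (blast intro: reach.start)
next
  case (step x \<beta> \<alpha>')
  then show ?case using reach.step[of x \<beta> "\<alpha> \<circ> \<alpha>'"] A_comp[of \<alpha> \<alpha>'] by simp
qed

lemma reach_P:
  assumes "x \<in> reach" "P x"
  obtains y \<alpha> \<beta> where "y \<in> reach" "\<not> P y" "\<beta> \<in> B" "\<alpha> \<in> C" "x = (\<alpha> \<circ> \<beta>) y"
  using assms(1)
proof cases
  case start
  then show ?thesis using base assms(2) by blast
next
  case (step y \<beta> \<alpha>)
  then have "\<alpha> \<in> C" using pong[of "\<beta> y" \<alpha>] B_Y[of \<beta>] reach_Y[of y] assms(2) by blast
  then show ?thesis using that[of y \<beta> \<alpha>] step by simp
qed

text \<open>
  If \<open>P x\<close> holds, then the last map applied was in \<open>C\<close>. Moved across it, \<open>\<beta>\<close> merges with the preceding map from \<open>B\<close>,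
  and the merged map is applied to a point without the property \<open>P\<close>.
\<close>

lemma reach_B:
  assumes "x \<in> reach" "\<beta> \<in> B"
  shows "\<beta> x \<in> reach"
proof -
  have *: "\<beta> y \<in> reach" if "y \<in> reach" "\<not> P y" "\<beta> \<in> B" for y \<beta>
    using ping[OF reach_Y[OF that(1)] that(3,2)] reach.step[OF that _ A_id] reach_A[OF that(1)] by auto
  show ?thesis
  proof (cases "P x")
    case True
    then obtain y \<alpha> \<beta>0 where y: "y \<in> reach" "\<not> P y" "\<beta>0 \<in> B" "\<alpha> \<in> C" "x = (\<alpha> \<circ> \<beta>0) y"
      by (rule reach_P[OF assms(1)])
    have "\<beta>0 y \<in> Y" using B_Y[OF y(3)] reach_Y[OF y(1)] by blast
    then obtain \<beta>' \<alpha>' where "\<beta>' \<in> B" "\<alpha>' \<in> A" "\<beta> x = \<alpha>' (\<beta>' (\<beta>0 y))"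
      using swap[OF y(4) assms(2)] unfolding y(5) by auto
    then show ?thesis
      using *[OF y(1,2) B_comp[of \<beta>' \<beta>0]] y(3) reach_A by simp
  qed (use * assms in blast)
qed

end

section \<open>Automorphisms\<close>

lemma Aut_mult [simp]: "\<phi> \<otimes>\<^bsub>Aut2\<^esub> \<psi> = \<phi> \<circ> \<psi>"
  by (simp add: Aut2_def)

lemma Aut_one [simp]: "\<one>\<^bsub>Aut2\<^esub> = id"
  by (simp add: Aut2_def)

lemma Aut_comp: "\<phi> \<in> carrier Aut2 \<Longrightarrow> \<psi> \<in> carrier Aut2 \<Longrightarrow> \<phi> \<circ> \<psi> \<in> carrier Aut2"
  using monoid.m_closed[OF group.is_monoid[OF group_Aut2]] by simp

lemma Aut_id: "id \<in> carrier Aut2"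
  using monoid.one_closed[OF group.is_monoid[OF group_Aut2]] by simp

lemma Aut_inv_closed: "\<phi> \<in> carrier Aut2 \<Longrightarrow> inv\<^bsub>Aut2\<^esub> \<phi> \<in> carrier Aut2"
  by (rule group.inv_closed[OF group_Aut2])

lemma Aut_inv:
  assumes "\<phi> \<in> carrier Aut2"
  shows "\<phi> ((inv\<^bsub>Aut2\<^esub> \<phi>) f) = f" "(inv\<^bsub>Aut2\<^esub> \<phi>) (\<phi> f) = f"
  using group.r_inv[OF group_Aut2 assms] group.l_inv[OF group_Aut2 assms]
  by (auto simp: fun_eq_iff)

lemma Aut_const: "\<phi> \<in> carrier Aut2 \<Longrightarrow> \<phi> (const2 c) = const2 c"
  by (simp add: Aut2_def alg_automorphism_def)

lemma Aut_hom:
  assumes "\<phi> \<in> carrier Aut2"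
  shows "is_hom \<phi>"
proof (rule is_homI)
  have "\<phi> (const2 1) = const2 1" using assms by (rule Aut_const)
  then show "\<phi> 1 = 1" by (simp add: const2_simps)
qed (use assms in \<open>simp_all add: Aut2_def alg_automorphism_def\<close>)

lemmas Aut_simps = hom_simps[OF Aut_hom]

lemma Aut_ev:
  assumes "\<phi> \<in> carrier Aut2"
  shows "\<phi> (ev p F) = ev p (\<phi> F)"
  by (rule hom_ev[OF Aut_hom[OF assms] Aut_const[OF assms]])

lemma Aut_inject:
  assumes "\<phi> \<in> carrier Aut2" "\<phi> f = \<phi> g"
  shows "f = g"
  using arg_cong[OF assms(2), of "inv\<^bsub>Aut2\<^esub> \<phi>"] by (simp only: Aut_inv[OF assms(1)])

lemma Aut_eqI:
  assumes "\<phi> \<in> carrier Aut2" "\<psi> \<in> carrier Aut2" "\<phi> (var 1) = \<psi> (var 1)" "\<phi> (var 2) = \<psi> (var 2)"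
  shows "\<phi> = \<psi>"
  by (rule ext, rule hom_eqI[OF Aut_hom[OF assms(1)] Aut_hom[OF assms(2)]])
    (simp_all add: assms(3,4) Aut_const[OF assms(1)] Aut_const[OF assms(2)])

lemma Aut_inv_eqI:
  assumes "\<phi> \<in> carrier Aut2" "\<And>f. \<phi> (\<psi> f) = f"
  shows "inv\<^bsub>Aut2\<^esub> \<phi> = \<psi>"
proof
  fix f
  show "(inv\<^bsub>Aut2\<^esub> \<phi>) f = \<psi> f"
    using Aut_inv(2)[OF assms(1), of "\<psi> f"] by (simp only: assms(2))
qed

lemma tdeg_coordinate_pos:
  assumes "\<phi> \<in> carrier Aut2"
  shows "tdeg (\<phi> (var i)) > 0"
proof (rule ccontr)
  assume "\<not> ?thesis"
  then obtain c where "\<phi> (var i) = const2 c"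
    using tdeg_eq_0_iff[of "\<phi> (var i)"] by auto
  then have "\<phi> (var i) = \<phi> (const2 c)"
    by (simp add: Aut_const[OF assms])
  then have "var i = (const2 c :: 'a poly poly)"
    by (rule Aut_inject[OF assms])
  then show False using tdeg_var[of i, where ?'a = 'a] by simp
qed

definition endo :: "'a::idom poly poly \<Rightarrow> 'a poly poly \<Rightarrow> 'a endo2"
  where "endo F G = subst2 const2 (\<lambda>i. if i = 1 then F else G)"

lemma is_hom_endo: "is_hom (endo F G)"
  unfolding endo_def by (rule is_hom_subst2[OF is_hom_const2])

lemmas endo_simps = hom_simps[OF is_hom_endo]

lemma endo_values [simp]:
  "endo F G (const2 c) = const2 c" "endo F G (var 1) = F" "endo F G (var 2) = G"
  by (simp_all add: endo_def is_hom_const2 const2_simps)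

lemma endo_ev: "endo F G (ev p H) = ev p (endo F G H)"
  by (simp add: hom_ev is_hom_endo)

lemma endo_in_Aut:
  assumes "endo F G F' = var 1" "endo F G G' = var 2" "endo F' G' F = var 1" "endo F' G' G = var 2"
  shows "endo F G \<in> carrier Aut2" "endo F' G' \<in> carrier Aut2"
proof -
  have *: "endo F G (endo F' G' f) = f" for f
    by (rule hom_eqI[OF is_hom_comp[OF is_hom_endo is_hom_endo] is_hom_id, of F G F' G']) (simp_all add: assms)
  have **: "endo F' G' (endo F G f) = f" for f
    by (rule hom_eqI[OF is_hom_comp[OF is_hom_endo is_hom_endo] is_hom_id, of F' G' F G]) (simp_all add: assms)
  show "endo F G \<in> carrier Aut2" "endo F' G' \<in> carrier Aut2"
    using o_bij[of "endo F' G'" "endo F G"] o_bij[of "endo F G" "endo F' G'"] * **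
    by (auto simp: Aut2_def alg_automorphism_def endo_simps fun_eq_iff)
qed

definition shear :: "'a::idom poly \<Rightarrow> 'a endo2"
  where "shear f = endo (var 1) (var 2 + ev f (var 1))"

lemma shear_simps [simp]: "shear f (const2 c) = const2 c" "shear f (var 1) = var 1"
  "shear f (var 2) = var 2 + ev f (var 1)"
  by (simp_all add: shear_def)

lemma shear_Aut: "shear f \<in> carrier Aut2"
  unfolding shear_def by (rule endo_in_Aut(1)[where F' = "var 1" and G' = "var 2 + ev (- f) (var 1)"])
    (simp_all add: endo_simps endo_ev)

lemmas shear_hom = Aut_simps[OF shear_Aut]

lemmas shear_ev = Aut_ev[OF shear_Aut]

lemma shear_add: "shear f (shear g F) = shear (f + g) F"
proof -
  have "shear f \<circ> shear g = shear (f + g)"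
    by (rule Aut_eqI) (simp_all add: shear_Aut Aut_comp shear_hom shear_ev algebra_simps)
  then show ?thesis by (simp add: fun_eq_iff)
qed

lemma shear_0: "shear 0 F = (F :: 'a::idom poly poly)"
proof -
  have "shear 0 = (id :: 'a endo2)" by (rule Aut_eqI) (simp_all add: shear_Aut Aut_id)
  then show ?thesis by simp
qed

lemma inv_shear: "inv\<^bsub>Aut2\<^esub> (shear f) = shear (- f)"
  by (rule Aut_inv_eqI) (simp_all add: shear_Aut shear_add shear_0)

text \<open>
  Elementary automorphisms need not be treated one by one: each is a shear up to the linear maps that scale
  \<open>x\<^sub>2\<close> or swap the variables.
\<close>

lemma generated_subset:
  fixes A G :: "'a::idom endo2 set"
  assumes A: "subgroup A Aut2" "Aff2 \<subseteq> A"
    and G: "id \<in> G" "\<And>\<phi> \<alpha>. \<phi> \<in> G \<Longrightarrow> \<alpha> \<in> A \<Longrightarrow> \<phi> \<circ> \<alpha> \<in> G"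
      "\<And>\<phi> f. \<phi> \<in> G \<Longrightarrow> \<phi> \<circ> shear f \<in> G"
  shows "generate Aut2 (A \<union> T2) \<subseteq> G"
proof -
  interpret Aut: group "Aut2 :: 'a endo2 monoid" by (rule group_Aut2)
  \<comment> \<open>As \<open>H\<close> is a subgroup, it contains the generated one as soon as it contains the generators.\<close>
  define H where "H = {\<psi> \<in> carrier Aut2. \<forall>\<phi>\<in>G. \<phi> \<circ> \<psi> \<in> G \<and> \<phi> \<circ> inv\<^bsub>Aut2\<^esub> \<psi> \<in> G}"
  have H: "subgroup H Aut2"
  proof (rule Aut.subgroupI)
    have "inv\<^bsub>Aut2\<^esub> id = (id :: 'a endo2)" using Aut.inv_one by simp
    then have "id \<in> H" using Aut_id by (simp add: H_def)
    then show "H \<noteq> {}" by blast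
    show "inv\<^bsub>Aut2\<^esub> \<psi> \<in> H" if "\<psi> \<in> H" for \<psi>
      using that Aut.inv_inv by (auto simp: H_def)
    show "\<psi> \<otimes>\<^bsub>Aut2\<^esub> \<psi>' \<in> H" if "\<psi> \<in> H" "\<psi>' \<in> H" for \<psi> \<psi>'
    proof -
      have "inv\<^bsub>Aut2\<^esub> (\<psi> \<circ> \<psi>') = inv\<^bsub>Aut2\<^esub> \<psi>' \<circ> inv\<^bsub>Aut2\<^esub> \<psi>"
        using that Aut.inv_mult_group[of \<psi> \<psi>'] by (auto simp: H_def)
      then show ?thesis
        using that Aut_comp by (auto simp: H_def comp_assoc[symmetric])
    qed
  qed (auto simp: H_def)
  note H_mult = subgroup.m_closed[OF H, simplified]
  have AH: "A \<subseteq> H"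
    using G(2) subgroup.subset[OF A(1)] subgroup.m_inv_closed[OF A(1)] by (auto simp: H_def)
  have shear_H: "shear f \<in> H" for f
    using G(3) by (simp add: H_def shear_Aut inv_shear)
  have Aff2_H: "\<phi> \<in> H" if "\<phi> \<in> carrier Aut2" "\<phi> (var 1) = const2 (M$1$1) * var 1 + const2 (M$2$1) * var 2"
      "\<phi> (var 2) = const2 (M$1$2) * var 1 + const2 (M$2$2) * var 2" "invertible M"
    for \<phi> and M :: "'a^2^2"
  proof -
    have "(\<chi> j. \<phi> (var j)) = (\<chi> i. var i) v* map_matrix const2 M + (\<chi> j. const2 ((0 :: 'a^2) $ j))"
      using that by (simp add: vec_eq_iff forall_2 vector_matrix_mult_def sum_2 map_matrix_def const2_simps mult.commute)
    then have "\<phi> \<in> Aff2"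
      unfolding Aff2_def using that(1,4) by blast
    then show ?thesis using A(2) AH by blast
  qed
  have elem: "\<phi> \<in> H" if \<phi>: "\<phi> \<in> carrier Aut2" "a dvd 1" "\<phi> (var 2) = const2 a * var 2 + ev p (var 1)" "\<phi> (var 1) = var 1"
    for \<phi> and a :: 'a and p
  proof -
    obtain b where b: "a * b = 1" using \<phi>(2) unfolding dvd_def by auto
    define \<delta> where "\<delta> = endo (var 1) (const2 a * var 2)"
    have "const2 a * const2 b = 1"
      using b by (simp add: const2_simps(1) flip: const2_simps(3))
    then have ab: "const2 a * (const2 b * F) = F" "const2 b * (const2 a * F) = F" for F
      by (simp_all add: mult.commute[of "const2 b" "const2 a"] flip: mult.assoc)
    have \<delta>: "\<delta> \<in> carrier Aut2"
      unfolding \<delta>_def by (rule endo_in_Aut(1)[where F' = "var 1" and G' = "const2 b * var 2"])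
        (simp_all add: endo_simps ab)
    define M where "M = (\<chi> i j. if i = (j::2) then if i = 1 then 1 else a else (0::'a))"
    have "invertible M"
      unfolding invertible_def
      by (rule exI[of _ "\<chi> i j. if i = (j::2) then if i = 1 then 1 else b else (0::'a)"])
        (use b in \<open>auto simp: M_def matrix_matrix_mult_def mat_def vec_eq_iff forall_2 sum_2 mult.commute\<close>)
    then have "\<delta> \<in> H"
      by (intro Aff2_H[where M = M] \<delta>) (auto simp: \<delta>_def M_def const2_simps)
    moreover have "\<phi> = \<delta> \<circ> shear p"
      by (rule Aut_eqI) (simp_all add: \<phi> Aut_comp \<delta> shear_Aut, simp_all add: \<delta>_def endo_simps endo_ev)
    ultimately show ?thesis using H_mult shear_H by metis
  qed
  define \<sigma> where "\<sigma> = endo (var 2) (var 1 :: 'a poly poly)"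
  have \<sigma>: "\<sigma> \<in> carrier Aut2"
    unfolding \<sigma>_def by (rule endo_in_Aut(1)[where F' = "var 2" and G' = "var 1"]) simp_all
  define S where "S = (\<chi> i j. if i = (j::2) then 0 else (1::'a))"
  have "invertible S"
    unfolding invertible_def
    by (rule exI[of _ S]) (auto simp: S_def matrix_matrix_mult_def mat_def vec_eq_iff forall_2 sum_2)
  then have \<sigma>_H: "\<sigma> \<in> H"
    by (intro Aff2_H[where M = S] \<sigma>) (auto simp: \<sigma>_def S_def const2_simps)
  have \<sigma>_inv: "\<sigma> (\<sigma> F) = F" for F
  proof -
    have "\<sigma> \<circ> \<sigma> = id" by (rule Aut_eqI) (simp_all add: \<sigma> Aut_comp Aut_id, simp_all add: \<sigma>_def)
    then show ?thesis by (simp add: fun_eq_iff)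
  qed
  have elem_H: "\<phi> \<in> H" if e: "elementary \<phi>" for \<phi>
  proof -
    obtain l m a p where \<phi>: "\<phi> \<in> carrier Aut2" "l \<noteq> m" "a dvd 1"
      "\<phi> (var l) = const2 a * var l + ev p (var m)" "\<phi> (var m) = var m"
      using e unfolding elementary_def ev_def by blast
    show ?thesis
    proof (cases "l = 1")
      case False
      then have "l = 2" "m = 1" using exhaust_2 \<phi>(2) by metis+
      then show ?thesis using elem \<phi> by blast
    next
      case True
      then have m: "m = 2" using exhaust_2 \<phi>(2) by metis
      have "\<sigma> \<circ> \<phi> \<circ> \<sigma> \<in> H"
        by (rule elem[OF _ \<phi>(3), of _ p])
          (use \<phi> True m in \<open>simp_all add: Aut_comp \<sigma>, simp_all add: \<sigma>_def endo_simps endo_ev\<close>)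
      then have "\<sigma> \<circ> (\<sigma> \<circ> \<phi> \<circ> \<sigma>) \<circ> \<sigma> \<in> H" using H_mult \<sigma>_H by blast
      moreover have "\<sigma> \<circ> (\<sigma> \<circ> \<phi> \<circ> \<sigma>) \<circ> \<sigma> = \<phi>" by (simp add: fun_eq_iff \<sigma>_inv)
      ultimately show ?thesis by simp
    qed
  qed
  have "E2 \<subseteq> H"
    unfolding E2_def using elem_H by (intro Aut.generate_subgroup_incl H) auto
  then have "T2 \<subseteq> H"
    unfolding T2_def using A(2) AH by (intro Aut.generate_subgroup_incl H) auto
  then have "generate Aut2 (A \<union> T2) \<subseteq> H"
    using AH by (intro Aut.generate_subgroup_incl H) auto
  also have "H \<subseteq> G" using G(1) by (force simp: H_def)
  finally show ?thesis .
qed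

section \<open>Affine groups over linearized polynomials\<close>

context frobenius_power
begin

definition split_form :: "'a poly poly \<Rightarrow> bool"
  where "split_form F \<longleftrightarrow> (\<exists>a b c. linearized s a \<and> linearized s b \<and> F = ev a (var 1) + ev b (var 2) + const2 c)"

text \<open>
  For \<open>s = 1\<close> this contains the affine automorphisms and for \<open>s = p\<close>, over an infinite domain, also the additive ones. The condition on the inverse
  makes the set a subgroup at once; that it holds for affine and additive automorphisms is shown separately.
\<close>

definition GAff :: "'a endo2 set"
  where "GAff = {\<phi> \<in> carrier Aut2. \<forall>i. split_form (\<phi> (var i)) \<and> split_form ((inv\<^bsub>Aut2\<^esub> \<phi>) (var i))}"

lemma linearized_degree_1:
  assumes "linearized s a" "degree a = 1"
  shows "\<exists>k. a = [:0, k:]"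
proof -
  have "coeff a 0 = 0"
    using assms(1) s_pos by (auto simp: linearized_def)
  moreover have "coeff a n = 0" if "n > 1" for n
    using assms(2) that by (simp add: coeff_eq_0)
  ultimately have "a = [:0, coeff a 1:]"
    by (intro poly_eqI) (auto simp: coeff_pCons split: nat.split)
  then show ?thesis by blast
qed

lemma split_formE:
  assumes "split_form F"
  obtains a b c where "linearized s a" "linearized s b" "F = ev a (var 1) + ev b (var 2) + const2 c"
  using assms unfolding split_form_def by blast

lemma split_form_add:
  assumes "split_form F" "split_form G"
  shows "split_form (F + G)"
proof -
  obtain a b c where F: "linearized s a" "linearized s b" "F = ev a (var 1) + ev b (var 2) + const2 c"
    using assms(1) by (rule split_formE)
  obtain a' b' c' where G: "linearized s a'" "linearized s b'" "G = ev a' (var 1) + ev b' (var 2) + const2 c'"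
    using assms(2) by (rule split_formE)
  have "F + G = ev (a + a') (var 1) + ev (b + b') (var 2) + const2 (c + c')"
    by (simp add: F G const2_simps)
  then show ?thesis unfolding split_form_def using F G linearized_add by blast
qed

lemma split_form_const: "split_form (const2 c)"
  unfolding split_form_def by (rule exI[of _ 0], rule exI[of _ 0]) auto

lemma split_form_ev_var: "linearized s a \<Longrightarrow> split_form (ev a (var i))"
  unfolding split_form_def using exhaust_2[of i]
  by (metis add.left_neutral add.right_neutral const2_eq_0_iff ev_simps(4) linearized_0)

lemma ev_const2: "ev a (const2 c) = const2 (poly a c)"
  by (induction a) (simp_all add: ev_pCons const2_simps)

lemma ev_linearized_0: "linearized s a \<Longrightarrow> ev a 0 = (0 :: 'a poly poly)"
  using ev_linearized_add[of a 0 0] by (metis add.right_neutral add_cancel_right_right)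

lemma split_form_ev:
  assumes "linearized s e" "split_form F"
  shows "split_form (ev e F)"
proof -
  obtain a b c where F: "linearized s a" "linearized s b" "F = ev a (var 1) + ev b (var 2) + const2 c"
    using assms(2) by (rule split_formE)
  have "ev e F = ev (pcompose e a) (var 1) + ev (pcompose e b) (var 2) + const2 (poly e c)"
    using assms(1) by (simp add: F ev_linearized_add ev_pcompose ev_const2)
  then show ?thesis unfolding split_form_def using F assms(1) linearized_pcompose by blast
qed

lemma split_form_comp:
  assumes "\<phi> \<in> carrier Aut2" "\<And>i. split_form (\<phi> (var i))" "split_form F"
  shows "split_form (\<phi> F)"
proof -
  obtain a b c where F: "linearized s a" "linearized s b" "F = ev a (var 1) + ev b (var 2) + const2 c"
    using assms(3) by (rule split_formE)
  have "\<phi> F = ev a (\<phi> (var 1)) + ev b (\<phi> (var 2)) + const2 c"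
    by (simp add: F Aut_simps[OF assms(1)] Aut_ev[OF assms(1)] Aut_const[OF assms(1)])
  then show ?thesis
    using F(1,2) assms(2) by (simp add: split_form_add split_form_const split_form_ev)
qed

lemma GAff_Aut: "\<alpha> \<in> GAff \<Longrightarrow> \<alpha> \<in> carrier Aut2"
  by (simp add: GAff_def)

lemma subgroup_GAff: "subgroup GAff Aut2"
proof -
  interpret Aut: group "Aut2 :: 'a endo2 monoid" by (rule group_Aut2)
  show ?thesis
  proof (rule Aut.subgroupI)
    have "inv\<^bsub>Aut2\<^esub> id = (id :: 'a endo2)" using Aut.inv_one by simp
    moreover have "split_form (var i)" for i
      using split_form_ev_var[OF linearized_scale[of s 1], of i] by simp
    ultimately have "id \<in> GAff" by (simp add: GAff_def Aut_id)
    then show "GAff \<noteq> {}" by blast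
    show "inv\<^bsub>Aut2\<^esub> \<phi> \<in> GAff" if "\<phi> \<in> GAff" for \<phi>
      using that Aut.inv_inv[of \<phi>] Aut_inv_closed[of \<phi>] by (auto simp: GAff_def)
    show "\<phi> \<otimes>\<^bsub>Aut2\<^esub> \<psi> \<in> GAff" if "\<phi> \<in> GAff" "\<psi> \<in> GAff" for \<phi> \<psi>
    proof -
      have "inv\<^bsub>Aut2\<^esub> (\<phi> \<circ> \<psi>) = inv\<^bsub>Aut2\<^esub> \<psi> \<circ> inv\<^bsub>Aut2\<^esub> \<phi>"
        using that Aut.inv_mult_group[of \<phi> \<psi>] by (auto simp: GAff_def)
      then show ?thesis
        using that by (simp add: GAff_def Aut_comp Aut_inv_closed split_form_comp)
    qed
  qed (auto simp: GAff_def)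
qed

lemma GAff_comp: "\<alpha> \<in> GAff \<Longrightarrow> \<beta> \<in> GAff \<Longrightarrow> \<alpha> \<circ> \<beta> \<in> GAff"
  using subgroup.m_closed[OF subgroup_GAff, of \<alpha> \<beta>] by simp

lemma shear_GAff:
  assumes "\<not> nonlinearized s f"
  shows "shear f \<in> GAff"
proof -
  have *: "split_form (shear f (var i))" if f: "\<not> nonlinearized s f" for f i
  proof -
    define l where "l = f - [:coeff f 0:]"
    have "n \<in> range ((^) s)" if "coeff l n \<noteq> 0" for n
      using that f by (cases n) (auto simp: l_def nonlinearized_def)
    then have l: "linearized s l" by (auto simp: linearized_def)
    have "f = l + [:coeff f 0:]" by (simp add: l_def)
    then have "ev f (var 1) = ev l (var 1) + const2 (coeff f 0)"
      by (metis ev_const ev_simps(2))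
    moreover have "split_form (ev l (var 1) + const2 (coeff f 0))"
      by (intro split_form_add split_form_ev_var split_form_const l)
    moreover have v: "split_form (var i)" for i
      using split_form_ev_var[OF linearized_scale[of s 1], of i] by simp
    ultimately show ?thesis
      using exhaust_2[of i] split_form_add by auto
  qed
  have "\<not> nonlinearized s (- f)" using assms by (simp add: nonlinearized_def)
  then show ?thesis
    using *[OF assms] * by (simp add: GAff_def shear_Aut inv_shear)
qed

text \<open>
  Otherwise the combinations of \<open>\<phi>(x\<^sub>1)\<close> and \<open>\<phi>(x\<^sub>2)\<close> that express \<open>x\<^sub>1\<close> and \<open>x\<^sub>2\<close>, having degree 1, could not involve
  \<open>\<phi>(x\<^sub>2)\<close>, and both variables would be affine functions of \<open>\<phi>(x\<^sub>1)\<close>,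
  hence linearly dependent up to constants.
\<close>

lemma GAff_not_detached:
  assumes "\<phi> \<in> GAff"
  shows "\<not> detached (\<phi> (var 1)) (\<phi> (var 2))"
proof
  assume det: "detached (\<phi> (var 1)) (\<phi> (var 2))"
  have \<phi>: "\<phi> \<in> carrier Aut2" using assms by (rule GAff_Aut)
  note [simp] = Aut_simps[OF \<phi>] Aut_ev[OF \<phi>] Aut_const[OF \<phi>]
  have pos: "tdeg (\<phi> (var 1)) > 0" by (rule tdeg_coordinate_pos[OF \<phi>])
  have *: "\<exists>k c. var i = const2 k * \<phi> (var 1) + const2 c" for i
  proof -
    have "split_form ((inv\<^bsub>Aut2\<^esub> \<phi>) (var i))" using assms by (simp add: GAff_def)
    then obtain a b c where ab: "linearized s a" "linearized s b"
      "(inv\<^bsub>Aut2\<^esub> \<phi>) (var i) = ev a (var 1) + ev b (var 2) + const2 c"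
      by (rule split_formE)
    have eq: "var i = ev a (\<phi> (var 1)) + ev b (\<phi> (var 2)) + const2 c"
      using arg_cong[OF ab(3), of \<phi>] by (simp add: Aut_inv[OF \<phi>])
    have "tdeg (ev a (\<phi> (var 1)) + ev b (\<phi> (var 2))) = 1"
      using arg_cong[OF eq, of tdeg] by simp
    then have "b = 0"
      using det ab(1,2) pos unfolding detached_def by (metis less_one not_gr_zero)
    then have eq': "var i = ev a (\<phi> (var 1)) + const2 c" using eq by simp
    have "degree a * tdeg (\<phi> (var 1)) = 1"
      using arg_cong[OF eq', of tdeg] by (simp add: tdeg_ev)
    then have "degree a = 1" by simp
    then obtain k where "a = [:0, k:]"
      using linearized_degree_1 ab(1) by blast
    then show ?thesis using eq' by (auto simp: ev_pCons const2_simps mult.commute)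
  qed
  obtain k1 c1 where 1: "var 1 = const2 k1 * \<phi> (var 1) + const2 c1" using * by blast
  obtain k2 c2 where 2: "var 2 = const2 k2 * \<phi> (var 1) + const2 c2" using * by blast
  have "const2 k2 * (var 1 :: 'a poly poly) - const2 k1 * var 2 = const2 (k2 * c1 - k1 * c2)"
    by (subst 1, subst 2) (simp add: const2_simps algebra_simps)
  then have "k1 = 0" by (simp add: const2_def var_def)
  then have "var 1 = (const2 c1 :: 'a poly poly)" using 1 by (simp add: const2_simps)
  then show False by (simp add: const2_def var_def)
qed

lemma split_form_linear: "split_form (const2 k * var i + const2 l * var j + const2 c)"
proof -
  have "split_form (const2 k * var i)" for k i
    using split_form_ev_var[OF linearized_scale[of s k], of i] by (simp add: ev_pCons const2_simps mult.commute)
  then show ?thesis by (intro split_form_add split_form_const)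
qed

text \<open>
  Only the inverse needs work: the relations \<open>x = \<psi>(x) M + b\<close> are solved for \<open>\<psi>(x)\<close> with the inverse matrix of \<open>M\<close>.
\<close>

lemma Aff2_subset_GAff: "Aff2 \<subseteq> GAff"
proof
  fix \<phi> :: "'a endo2"
  assume "\<phi> \<in> Aff2"
  then obtain M :: "'a^2^2" and b :: "'a^2" where \<phi>: "\<phi> \<in> carrier Aut2" and M: "invertible M"
    and eq: "(\<chi> j. \<phi> (var j)) = (\<chi> i. var i) v* map_matrix const2 M + (\<chi> j. const2 (b $ j))"
    unfolding Aff2_def by blast
  have val: "\<phi> (var j) = const2 (M $ 1 $ j) * var 1 + const2 (M $ 2 $ j) * var 2 + const2 (b $ j)" for j
    using arg_cong[OF eq, of "\<lambda>v. v $ j"]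
    by (simp add: vector_matrix_mult_def sum_2 map_matrix_def mult.commute)
  define \<psi> where "\<psi> = inv\<^bsub>Aut2\<^esub> \<phi>"
  have \<psi>: "\<psi> \<in> carrier Aut2" unfolding \<psi>_def by (rule Aut_inv_closed[OF \<phi>])
  have inv: "var j = const2 (M $ 1 $ j) * \<psi> (var 1) + const2 (M $ 2 $ j) * \<psi> (var 2) + const2 (b $ j)" for j
    using arg_cong[OF val, of \<psi> j]
    by (simp add: Aut_inv[OF \<phi>, folded \<psi>_def] hom_add[OF Aut_hom[OF \<psi>]] hom_mult[OF Aut_hom[OF \<psi>]] Aut_const[OF \<psi>])
  obtain N where N: "M ** N = mat 1" using M unfolding invertible_def by blast
  have MN: "M $ i $ 1 * N $ 1 $ k + M $ i $ 2 * N $ 2 $ k = (if i = k then 1 else 0)" for i k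
    using arg_cong[OF N, of "\<lambda>X. X $ i $ k"] by (simp add: matrix_matrix_mult_def sum_2 mat_def)
  have "split_form (\<psi> (var k))" for k
  proof -
    have "const2 (N $ 1 $ k) * (var 1 - const2 (b $ 1)) + const2 (N $ 2 $ k) * (var 2 - const2 (b $ 2))
      = const2 (M $ 1 $ 1 * N $ 1 $ k + M $ 1 $ 2 * N $ 2 $ k) * \<psi> (var 1)
        + const2 (M $ 2 $ 1 * N $ 1 $ k + M $ 2 $ 2 * N $ 2 $ k) * \<psi> (var 2)"
      by (subst inv[of 1], subst inv[of 2]) (simp add: const2_simps algebra_simps)
    also have "\<dots> = \<psi> (var k)"
      using exhaust_2[of k] by (auto simp: MN const2_simps)
    finally have "\<psi> (var k) = const2 (N $ 1 $ k) * var 1 + const2 (N $ 2 $ k) * var 2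
        + const2 (- (N $ 1 $ k * b $ 1 + N $ 2 $ k * b $ 2))"
      by (simp add: const2_simps algebra_simps)
    then show ?thesis by (simp only: split_form_linear)
  qed
  moreover have "split_form (\<phi> (var k))" for k
    by (simp only: val split_form_linear)
  ultimately show "\<phi> \<in> GAff"
    using \<phi> by (simp add: GAff_def \<psi>_def)
qed

definition triang :: "'a endo2 \<Rightarrow> bool"
  where "triang \<alpha> \<longleftrightarrow> (\<exists>u c. u dvd 1 \<and> \<alpha> (var 1) = const2 u * var 1 + const2 c)"

text \<open>
  The step of the ping-pong in which an element of \<open>GAff\<close> acts. Let \<open>F\<close> and \<open>G\<close> be the pairs belonging to \<open>\<phi>\<close> and \<open>\<phi> \<circ> \<alpha>\<close>.
  If \<open>\<alpha>(x\<^sub>1)\<close> involves \<open>x\<^sub>2\<close>, then \<open>G\<^sub>1\<close> has larger degree than \<open>F\<^sub>1\<close>, because \<open>F\<close> is detached.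
  But \<open>F\<^sub>1\<close> is a combination of \<open>G\<^sub>1\<close> and \<open>G\<^sub>2\<close>, and \<open>G\<close> is detached, so its degree is at least that of \<open>G\<^sub>1\<close>.
\<close>

lemma detached_triang:
  assumes \<phi>: "\<phi> \<in> carrier Aut2" and \<alpha>: "\<alpha> \<in> GAff"
    and det: "detached (\<phi> (var 1)) (\<phi> (var 2))" "detached ((\<phi> \<circ> \<alpha>) (var 1)) ((\<phi> \<circ> \<alpha>) (var 2))"
  shows "triang \<alpha>"
proof -
  have \<alpha>A: "\<alpha> \<in> carrier Aut2" using \<alpha> by (rule GAff_Aut)
  define \<beta> where "\<beta> = inv\<^bsub>Aut2\<^esub> \<alpha>"
  have \<beta>A: "\<beta> \<in> carrier Aut2" unfolding \<beta>_def by (rule Aut_inv_closed[OF \<alpha>A])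
  note [simp] = Aut_simps[OF \<phi>] Aut_ev[OF \<phi>] Aut_const[OF \<phi>]
    Aut_simps[OF \<alpha>A] Aut_ev[OF \<alpha>A] Aut_const[OF \<alpha>A] Aut_inv[OF \<alpha>A, folded \<beta>_def]
    Aut_simps[OF \<beta>A] Aut_ev[OF \<beta>A] Aut_const[OF \<beta>A]
  have "split_form (\<alpha> (var 1))" "split_form (\<beta> (var 1))"
    using \<alpha> by (simp_all add: GAff_def \<beta>_def)
  then obtain a b c a' b' c' where
    ab: "linearized s a" "linearized s b" "\<alpha> (var 1) = ev a (var 1) + ev b (var 2) + const2 c"
    and ab': "linearized s a'" "linearized s b'" "\<beta> (var 1) = ev a' (var 1) + ev b' (var 2) + const2 c'"
    by (metis split_formE)
  define F1 F2 G1 G2 where FG: "F1 = \<phi> (var 1)" "F2 = \<phi> (var 2)" "G1 = \<phi> (\<alpha> (var 1))" "G2 = \<phi> (\<alpha> (var 2))"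
  have G1: "G1 = ev a F1 + ev b F2 + const2 c"
    by (simp add: FG ab(3))
  have F1: "F1 = ev a' G1 + ev b' G2 + const2 c'"
    using arg_cong[OF ab'(3), of "\<lambda>F. \<phi> (\<alpha> F)"] by (simp add: FG)
  have "b = 0"
  proof (rule ccontr)
    assume "b \<noteq> 0"
    then have lt: "tdeg F1 < tdeg G1"
      using det(1) ab(1,2) by (simp add: detached_def G1 FG(1,2))
    have "tdeg G1 \<le> tdeg F1"
    proof (cases "b' = 0")
      case True
      then have "tdeg F1 = degree a' * tdeg G1"
        using arg_cong[OF F1, of tdeg] by (simp add: tdeg_ev)
      moreover have "tdeg F1 > 0" unfolding FG by (rule tdeg_coordinate_pos[OF \<phi>])
      ultimately show ?thesis by (cases "degree a'") simp_all
    next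
      case False
      then have "tdeg G1 < tdeg (ev a' G1 + ev b' G2)"
        using det(2) ab'(1,2) by (simp add: detached_def FG)
      then show ?thesis using arg_cong[OF F1, of tdeg] by simp
    qed
    then show False using lt by simp
  qed
  then have \<alpha>1: "\<alpha> (var 1) = ev a (var 1) + const2 c" using ab(3) by simp
  have \<beta>1: "var 1 = ev a (\<beta> (var 1)) + const2 c"
    using arg_cong[OF \<alpha>1, of \<beta>] by simp
  have "degree a * tdeg (\<beta> (var 1)) = 1"
    using arg_cong[OF \<beta>1, of tdeg] by (simp add: tdeg_ev)
  then have "degree a = 1" by simp
  then obtain u where u: "a = [:0, u:]"
    using linearized_degree_1 ab(1) by blast
  \<comment> \<open>The coefficient of \<open>x\<^sub>1\<close> in \<open>x\<^sub>1 = u \<beta>(x\<^sub>1) + c\<close> shows that \<open>u\<close> is a unit.\<close>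
  have "coeff (coeff (var 1 :: 'a poly poly) 0) 1 = u * coeff (coeff (\<beta> (var 1)) 0) 1"
    by (subst \<beta>1) (simp add: u ev_pCons const2_simps, simp add: const2_def)
  moreover have "coeff (coeff (var 1 :: 'a poly poly) 0) 1 = 1"
    by (simp add: var_def)
  ultimately have "u dvd 1" by (metis dvd_triv_left)
  moreover have "\<alpha> (var 1) = const2 u * var 1 + const2 c"
    by (simp add: \<alpha>1 u ev_pCons const2_simps mult.commute)
  ultimately show ?thesis unfolding triang_def by blast
qed

text \<open>
  The conjugate of a shear by a triangular \<open>\<alpha>\<close> fixes \<open>x\<^sub>1\<close> and adds to \<open>x\<^sub>2\<close> a polynomial in \<open>x\<^sub>1\<close>.
\<close>

lemma triang_shear:
  assumes \<alpha>: "\<alpha> \<in> GAff" and "triang \<alpha>"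
  shows "\<exists>g. \<alpha> \<circ> shear f = shear g \<circ> \<alpha>"
proof -
  have \<alpha>A: "\<alpha> \<in> carrier Aut2" using \<alpha> by (rule GAff_Aut)
  define \<beta> where "\<beta> = inv\<^bsub>Aut2\<^esub> \<alpha>"
  have \<beta>A: "\<beta> \<in> carrier Aut2" unfolding \<beta>_def by (rule Aut_inv_closed[OF \<alpha>A])
  note [simp] = Aut_simps[OF \<alpha>A] Aut_ev[OF \<alpha>A] Aut_const[OF \<alpha>A] Aut_inv[OF \<alpha>A, folded \<beta>_def]
    Aut_simps[OF \<beta>A] Aut_ev[OF \<beta>A] Aut_const[OF \<beta>A]
  obtain u c where u: "u dvd 1" "\<alpha> (var 1) = const2 u * var 1 + const2 c"
    using assms(2) by (auto simp: triang_def)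
  obtain w where w: "w * u = 1" using u(1) by (auto simp: dvd_def mult.commute)
  have "split_form (\<beta> (var 2))" using \<alpha> by (simp add: GAff_def \<beta>_def)
  then obtain a b k where ab: "linearized s a" "linearized s b" "\<beta> (var 2) = ev a (var 1) + ev b (var 2) + const2 k"
    by (rule split_formE)
  have \<beta>1: "\<beta> (var 1) = const2 w * (var 1 - const2 c)"
  proof -
    have "var 1 = const2 u * \<beta> (var 1) + const2 c"
      using arg_cong[OF u(2), of \<beta>] by simp
    then have "var 1 - const2 c = const2 u * \<beta> (var 1)"
      by (metis add_diff_cancel_right')
    then have "const2 w * (var 1 - const2 c) = const2 (w * u) * \<beta> (var 1)"
      by (simp only: const2_simps mult.assoc)
    then show ?thesis by (simp add: w const2_simps)
  qed
  define g where "g = pcompose b (pcompose f [:c, u:])"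
  have g: "ev g (var 1) = ev b (ev f (\<alpha> (var 1)))"
    by (simp add: g_def ev_pcompose ev_pCons u(2) algebra_simps const2_simps)
  have "\<alpha> \<circ> shear f \<circ> \<beta> = shear g"
  proof (rule Aut_eqI)
    have "shear f (\<beta> (var 1)) = \<beta> (var 1)"
      by (simp add: \<beta>1 shear_hom)
    then show "(\<alpha> \<circ> shear f \<circ> \<beta>) (var 1) = shear g (var 1)" by simp
    have "shear f (\<beta> (var 2)) = \<beta> (var 2) + ev b (ev f (var 1))"
      by (simp add: ab shear_hom shear_ev ev_linearized_add algebra_simps)
    then show "(\<alpha> \<circ> shear f \<circ> \<beta>) (var 2) = shear g (var 2)"
      by (simp add: g)
  qed (simp_all add: Aut_comp \<alpha>A \<beta>A shear_Aut)
  then have "\<alpha> \<circ> shear f \<circ> \<beta> \<circ> \<alpha> = shear g \<circ> \<alpha>" by simp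
  then show ?thesis by (auto simp: fun_eq_iff)
qed

text \<open>
  The ping-pong is played with the regular action: the pair \<open>(\<phi>(x\<^sub>1), \<phi>(x\<^sub>2))\<close> of a word changes by right multiplication.
\<close>

definition right_mult :: "'a endo2 set \<Rightarrow> ('a endo2 \<Rightarrow> 'a endo2) set"
  where "right_mult S = (\<lambda>\<alpha> \<phi>. \<phi> \<circ> \<alpha>) ` S"

definition detached_aut :: "'a endo2 \<Rightarrow> bool"
  where "detached_aut \<phi> \<longleftrightarrow> detached (\<phi> (var 1)) (\<phi> (var 2))"

lemma right_multI: "\<alpha> \<in> S \<Longrightarrow> (\<lambda>\<phi>. \<phi> \<circ> \<alpha>) \<in> right_mult S"
  by (simp add: right_mult_def)

lemma right_multE:
  assumes "g \<in> right_mult S"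
  obtains \<alpha> where "\<alpha> \<in> S" "g = (\<lambda>\<phi>. \<phi> \<circ> \<alpha>)"
  using assms by (auto simp: right_mult_def)

lemma right_mult_comp:
  assumes "g \<in> right_mult S" "h \<in> right_mult S" "\<And>\<alpha> \<beta>. \<alpha> \<in> S \<Longrightarrow> \<beta> \<in> S \<Longrightarrow> \<alpha> \<circ> \<beta> \<in> S"
  shows "g \<circ> h \<in> right_mult S"
proof -
  obtain \<alpha> where \<alpha>: "\<alpha> \<in> S" "g = (\<lambda>\<phi>. \<phi> \<circ> \<alpha>)" using assms(1) by (rule right_multE)
  obtain \<beta> where \<beta>: "\<beta> \<in> S" "h = (\<lambda>\<phi>. \<phi> \<circ> \<beta>)" using assms(2) by (rule right_multE)
  have "g \<circ> h = (\<lambda>\<phi>. \<phi> \<circ> (\<beta> \<circ> \<alpha>))" by (simp add: \<alpha> \<beta> fun_eq_iff)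
  then show ?thesis using right_multI[OF assms(3)[OF \<beta>(1) \<alpha>(1)]] by simp
qed

lemma right_mult_Aut:
  assumes "g \<in> right_mult S" "S \<subseteq> carrier Aut2"
  shows "g ` carrier Aut2 \<subseteq> carrier Aut2"
  using assms Aut_comp by (auto elim!: right_multE)

lemma ping_pong_GAff:
  "ping_pong (carrier Aut2) GAff (right_mult GAff) (right_mult (range shear))
    (right_mult {\<alpha> \<in> GAff. triang \<alpha>}) detached_aut"
proof (rule ping_pong.intro)
  show "GAff \<subseteq> carrier Aut2" using GAff_Aut by blast
  show "\<not> detached_aut \<phi>" if "\<phi> \<in> GAff" for \<phi>
    unfolding detached_aut_def using that by (rule GAff_not_detached)
  show "g ` GAff \<subseteq> GAff" if g: "g \<in> right_mult GAff" for g
    using g GAff_comp by (auto elim!: right_multE)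
  have "id \<in> GAff" using subgroup.one_closed[OF subgroup_GAff] by simp
  from right_multI[OF this] show "id \<in> right_mult GAff" by (simp add: id_def[symmetric])
  show "g \<circ> h \<in> right_mult GAff" if "g \<in> right_mult GAff" "h \<in> right_mult GAff" for g h
    by (rule right_mult_comp[OF that]) (rule GAff_comp)
  have sh: "\<alpha> \<circ> \<beta> \<in> range shear" if ab: "\<alpha> \<in> range shear" "\<beta> \<in> range shear" for \<alpha> \<beta> :: "'a endo2"
  proof -
    obtain f g where "\<alpha> = shear f" "\<beta> = shear g" using ab by blast
    then have "\<alpha> \<circ> \<beta> = shear (f + g)" by (simp add: fun_eq_iff shear_add)
    then show ?thesis by blast
  qed
  show "g \<circ> h \<in> right_mult (range shear)" if "g \<in> right_mult (range shear)" "h \<in> right_mult (range shear)" for g h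
    by (rule right_mult_comp[OF that]) (rule sh)
  show "g ` carrier Aut2 \<subseteq> carrier Aut2" if "g \<in> right_mult GAff" for g
    by (rule right_mult_Aut[OF that]) (use GAff_Aut in blast)
  show "g ` carrier Aut2 \<subseteq> carrier Aut2" if "g \<in> right_mult (range shear)" for g
    by (rule right_mult_Aut[OF that]) (use shear_Aut in blast)
  show "detached_aut (g \<phi>) \<or> (\<exists>h\<in>right_mult GAff. g \<phi> = h \<phi>)"
    if \<phi>: "\<phi> \<in> carrier Aut2" and g: "g \<in> right_mult (range shear)" and nd: "\<not> detached_aut \<phi>" for \<phi> g
  proof -
    obtain f where g: "g = (\<lambda>\<phi>. \<phi> \<circ> shear f)"
      using g unfolding right_mult_def by blast
    have g1: "g \<phi> (var 1) = \<phi> (var 1)" and g2: "g \<phi> (var 2) = const2 1 * \<phi> (var 2) + ev f (\<phi> (var 1))"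
      by (simp_all add: g hom_add[OF Aut_hom[OF \<phi>]] Aut_ev[OF \<phi>] const2_simps(1))
    show ?thesis
    proof (cases "nonlinearized s f")
      case True
      have "detached_aut (g \<phi>)"
        unfolding detached_aut_def g1 g2
        by (rule detached_shear[OF tdeg_coordinate_pos[OF \<phi>] nd[unfolded detached_aut_def] _ True]) simp
      then show ?thesis by blast
    next
      case False
      have "g \<in> right_mult GAff"
        unfolding g by (rule right_multI[OF shear_GAff[OF False]])
      then show ?thesis by (intro disjI2 bexI[of _ g] refl)
    qed
  qed
  show "g \<in> right_mult {\<alpha> \<in> GAff. triang \<alpha>}"
    if \<phi>: "\<phi> \<in> carrier Aut2" and g: "g \<in> right_mult GAff" and det: "detached_aut \<phi>" "detached_aut (g \<phi>)" for \<phi> g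
  proof -
    obtain \<alpha> where \<alpha>: "\<alpha> \<in> GAff" "g = (\<lambda>\<phi>. \<phi> \<circ> \<alpha>)" using g by (rule right_multE)
    have "triang \<alpha>"
      using det unfolding \<alpha>(2) detached_aut_def by (rule detached_triang[OF \<phi> \<alpha>(1)])
    then show ?thesis unfolding \<alpha>(2) using \<alpha>(1) by (intro right_multI) simp
  qed
  show "\<exists>b'\<in>right_mult (range shear). \<exists>g'\<in>right_mult GAff. \<forall>\<phi>\<in>carrier Aut2. (b \<circ> g) \<phi> = (g' \<circ> b') \<phi>"
    if g: "g \<in> right_mult {\<alpha> \<in> GAff. triang \<alpha>}" and b: "b \<in> right_mult (range shear)" for g b
  proof -
    obtain \<alpha> where \<alpha>: "\<alpha> \<in> GAff" "triang \<alpha>" "g = (\<lambda>\<phi>. \<phi> \<circ> \<alpha>)" using g unfolding right_mult_def by blast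
    obtain f where f: "b = (\<lambda>\<phi>. \<phi> \<circ> shear f)" using b unfolding right_mult_def by blast
    obtain h where "\<alpha> \<circ> shear f = shear h \<circ> \<alpha>"
      using triang_shear[OF \<alpha>(1,2)] by blast
    then have eq: "\<forall>\<phi>\<in>carrier Aut2. (b \<circ> g) \<phi> = ((\<lambda>\<phi>. \<phi> \<circ> \<alpha>) \<circ> (\<lambda>\<phi>. \<phi> \<circ> shear h)) \<phi>"
      by (simp add: \<alpha>(3) f comp_assoc)
    show ?thesis
    proof (rule bexI[where x = "\<lambda>\<phi>. \<phi> \<circ> shear h"], rule bexI[where x = "\<lambda>\<phi>. \<phi> \<circ> \<alpha>"])
      show "(\<lambda>\<phi>. \<phi> \<circ> \<alpha>) \<in> right_mult GAff" using \<alpha>(1) by (rule right_multI)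
      show "(\<lambda>\<phi>. \<phi> \<circ> shear h) \<in> right_mult (range shear)" by (rule right_multI) simp
    qed (rule eq)
  qed
qed

text \<open>
  The hypothesis on the degree says that \<open>\<phi>(x\<^sub>2)\<close> equals \<open>- \<phi>(x\<^sub>1)\<^sup>m / a\<close> up to terms of low degree, so the pair of \<open>\<phi>\<close> is
  detached. If \<open>\<phi>\<close> were in the group, then its last shear \<open>f\<close> could be split off. Up to units and
  linearized terms, \<open>f\<close> would have to cancel \<open>x\<^sub>1\<^sup>m / a\<close>, which a polynomial with coefficients in the domain cannot do, because \<open>m\<close> is
  not a power of \<open>s\<close> and \<open>a\<close> is not a unit.
\<close>

lemma outside_generated:
  assumes \<phi>: "\<phi> \<in> carrier Aut2" and a: "a \<noteq> 0" "\<not> a dvd 1" and m: "m > 0" "m \<notin> range ((^) s)"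
    and le: "tdeg (const2 a * \<phi> (var 2) + \<phi> (var 1) ^ m) \<le> tdeg (\<phi> (var 1))"
  shows "\<phi> \<notin> generate Aut2 (GAff \<union> T2)"
proof
  assume gen: "\<phi> \<in> generate Aut2 (GAff \<union> T2)"
  interpret ping_pong "carrier Aut2" GAff "right_mult GAff" "right_mult (range shear)"
    "right_mult {\<alpha> \<in> GAff. triang \<alpha>}" detached_aut
    by (rule ping_pong_GAff)
  have "generate Aut2 (GAff \<union> T2) \<subseteq> reach"
  proof (rule generated_subset[OF subgroup_GAff Aff2_subset_GAff])
    show "id \<in> reach" using subgroup.one_closed[OF subgroup_GAff] reach.start by simp
    show "\<phi> \<circ> \<alpha> \<in> reach" if "\<phi> \<in> reach" "\<alpha> \<in> GAff" for \<phi> \<alpha>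
      using reach_A[OF that(1) right_multI[OF that(2)]] .
    show "\<phi> \<circ> shear f \<in> reach" if "\<phi> \<in> reach" for \<phi> f
      using reach_B[OF that right_multI[OF rangeI]] .
  qed
  then have reach: "\<phi> \<in> reach" using gen by blast
  define F1 F2 where F: "F1 = \<phi> (var 1)" "F2 = \<phi> (var 2)"
  have pos: "tdeg F1 > 0" unfolding F by (rule tdeg_coordinate_pos[OF \<phi>])
  have "\<not> detached F1 (const2 a * F2 + ev (monom 1 m) F1)"
  proof
    assume "detached F1 (const2 a * F2 + ev (monom 1 m) F1)"
    then have "tdeg F1 < tdeg (ev 0 F1 + ev [:0, 1:] (const2 a * F2 + ev (monom 1 m) F1))"
      unfolding detached_def using linearized_0 linearized_scale by (metis pCons_eq_0_iff zero_neq_one)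
    then show False using le by (simp add: F ev_monom const2_simps)
  qed
  moreover have "nonlinearized s (monom (1::'a) m)"
    using m by (auto simp: nonlinearized_def)
  ultimately have "detached F1 F2"
    using detached_shear[OF pos, of F2 a "monom 1 m"] a(1) by blast
  then have "detached_aut \<phi>" by (simp add: detached_aut_def F)
  then obtain \<psi> g h where \<psi>: "\<psi> \<in> reach" "\<not> detached_aut \<psi>"
    and gh: "h \<in> right_mult (range shear)" "g \<in> right_mult {\<alpha> \<in> GAff. triang \<alpha>}" "\<phi> = (g \<circ> h) \<psi>"
    by (rule reach_P[OF reach])
  obtain \<alpha> where \<alpha>: "\<alpha> \<in> GAff" "triang \<alpha>" and g: "g = (\<lambda>\<phi>. \<phi> \<circ> \<alpha>)"
    using gh(2) unfolding right_mult_def by blast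
  obtain f where h: "h = (\<lambda>\<phi>. \<phi> \<circ> shear f)"
    using gh(1) unfolding right_mult_def by blast
  have \<phi>_eq: "\<phi> = \<psi> \<circ> shear f \<circ> \<alpha>" by (simp add: gh(3) g h)
  have \<psi>A: "\<psi> \<in> carrier Aut2" using reach_Y[OF \<psi>(1)] .
  have \<alpha>A: "\<alpha> \<in> carrier Aut2" using \<alpha>(1) by (rule GAff_Aut)
  define \<beta> where "\<beta> = inv\<^bsub>Aut2\<^esub> \<alpha>"
  note [simp] = Aut_simps[OF \<alpha>A] Aut_ev[OF \<alpha>A] Aut_const[OF \<alpha>A] Aut_inv[OF \<alpha>A, folded \<beta>_def]
    Aut_simps[OF \<psi>A] Aut_ev[OF \<psi>A] Aut_const[OF \<psi>A] shear_hom shear_ev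
  obtain u c where u: "u dvd 1" "\<alpha> (var 1) = const2 u * var 1 + const2 c"
    using \<alpha>(2) by (auto simp: triang_def)
  have "split_form (\<alpha> (var 2))" "split_form (\<beta> (var 2))"
    using \<alpha>(1) by (simp_all add: GAff_def \<beta>_def)
  then obtain p q k p' q' k' where
    pq: "linearized s p" "linearized s q" "\<alpha> (var 2) = ev p (var 1) + ev q (var 2) + const2 k"
    and pq': "linearized s p'" "linearized s q'" "\<beta> (var 2) = ev p' (var 1) + ev q' (var 2) + const2 k'"
    by (metis split_formE)
  have "degree q = 1"
  proof -
    \<comment> \<open>Setting \<open>x\<^sub>1 = 0\<close> in \<open>x\<^sub>2 = \<alpha>(\<beta>(x\<^sub>2))\<close> leaves \<open>x\<^sub>2 = q'(q(x\<^sub>2))\<close> up to a constant.\<close>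
    have "endo 0 (var 2) (var 2) = endo 0 (var 2) (\<alpha> (\<beta> (var 2)))" by simp
    also have "\<dots> = endo 0 (var 2) (ev p' (\<alpha> (var 1)) + ev q' (\<alpha> (var 2)) + const2 k')"
      by (subst pq'(3)) simp
    also have "\<dots> = ev q' (ev q (var 2)) + const2 (poly p' c + poly q' k + k')"
      using pq(1,2) pq'(1,2)
      by (simp add: u pq(3) endo_simps endo_ev ev_linearized_add ev_linearized_0 ev_const2 const2_simps)
    finally have eq: "var 2 = ev q' (ev q (var 2)) + const2 (poly p' c + poly q' k + k')" by simp
    have "tdeg (var 2 :: 'a poly poly) = tdeg (ev q' (ev q (var 2)))"
      using arg_cong[OF eq, of tdeg] by simp
    then show ?thesis by (simp add: tdeg_ev)
  qed
  then obtain v where q: "q = [:0, v:]"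
    using linearized_degree_1 pq(2) by blast
  with \<open>degree q = 1\<close> have v: "v \<noteq> 0" by auto
  define G1 G2 where G: "G1 = \<psi> (var 1)" "G2 = \<psi> (var 2)"
  have F1: "F1 = const2 u * G1 + const2 c"
    by (simp add: F G \<phi>_eq u(2))
  have F2: "F2 = ev p G1 + const2 v * (G2 + ev f G1) + const2 k"
    by (simp add: F G \<phi>_eq pq(3) q ev_pCons const2_simps mult.commute algebra_simps)
  define f' where "f' = smult a p + smult (a * v) f + [:c, u:] ^ m + [:a * k:]"
  have eq: "const2 a * F2 + F1 ^ m = const2 (a * v) * G2 + ev f' G1"
    by (simp add: F1 F2 f'_def ev_smult const2_simps ev_pCons algebra_simps)
  have "coeff f' m \<noteq> 0"
  proof
    \<comment> \<open>Modulo \<open>a\<close>, the coefficient at \<open>m\<close> is the unit \<open>u ^ m\<close>.\<close>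
    assume "coeff f' m = 0"
    moreover have "coeff p m = 0" using pq(1) m(2) by (auto simp: linearized_def)
    moreover have "coeff ([:c, u:] ^ m) m = u ^ m" by (simp add: coeff_linear_poly_power)
    moreover have "coeff [:a * k:] m = 0" using m(1) by (cases m) auto
    ultimately have "a * (v * coeff f m) + u ^ m = 0" by (simp add: f'_def mult.assoc)
    then have "a dvd u ^ m" by (metis add.inverse_unique dvd_minus_iff dvd_triv_left)
    moreover have "u ^ m dvd 1" using u(1) by (metis dvd_power_same power_one)
    ultimately show False using a(2) dvd_trans by blast
  qed
  then have "nonlinearized s f'" using m by (auto simp: nonlinearized_def)
  then have "detached G1 (const2 (a * v) * G2 + ev f' G1)"
    using detached_shear[OF tdeg_coordinate_pos[OF \<psi>A] \<psi>(2)[unfolded detached_aut_def]] a(1) v unfolding G by simp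
  then have "tdeg G1 < tdeg (ev 0 G1 + ev [:0, 1:] (const2 (a * v) * G2 + ev f' G1))"
    unfolding detached_def using linearized_0 linearized_scale by (metis pCons_eq_0_iff zero_neq_one)
  then have "tdeg G1 < tdeg (const2 a * F2 + F1 ^ m)" by (simp add: eq)
  moreover have "u \<noteq> 0" using u(1) by auto
  then have "tdeg F1 = tdeg G1" by (simp add: F1)
  ultimately show False using le by (simp add: F)
qed

end

section \<open>Additive automorphisms\<close>

lemma Transl2_subset_Aff2: "Transl2 \<subseteq> Aff2"
proof -
  have "invertible (mat 1 :: 'a::idom^2^2)" by (simp add: invertible_def exI[of _ "mat 1"])
  then show ?thesis unfolding Transl2_def Aff2_def by blast
qed

text \<open>
  Evaluation at a point of the plane. A domain that is not a field is infinite, so that its polynomials may be replaced by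
  their functions; additivity of an inverse is then obvious.
\<close>

definition pt :: "(2 \<Rightarrow> 'a::comm_ring_1) \<Rightarrow> 'a poly poly \<Rightarrow> 'a"
  where "pt u = subst2 (\<lambda>c. c) u"

lemma is_hom_pt: "is_hom (pt u)"
  unfolding pt_def by (rule is_hom_subst2[OF is_hom_id])

lemmas pt_simps = hom_simps[OF is_hom_pt]

lemma pt_const2 [simp]: "pt u (const2 c) = c"
  by (simp add: pt_def)

lemma pt_var [simp]: "pt u (var i) = u i"
  by (simp add: pt_def is_hom_id)

lemma pt_poly: "pt u f = poly (map_poly (\<lambda>c. poly c (u 1)) f) (u 2)"
  by (simp add: pt_def subst2_def)

lemma pt_ev: "pt u (ev p F) = poly p (pt u F)"
  by (induction p) (simp_all add: ev_pCons pt_simps)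

lemma pt_Aut:
  assumes "\<phi> \<in> carrier Aut2"
  shows "pt u (\<phi> f) = pt (\<lambda>i. pt u (\<phi> (var i))) f"
  by (rule hom_eqI[where g = "\<lambda>f. pt u (\<phi> f)", OF is_hom_comp[OF is_hom_pt Aut_hom[OF assms]] is_hom_pt])
    (simp_all add: Aut_const[OF assms])

text \<open>
  The formal identity in \<open>R[y\<^sub>1, y\<^sub>2][z\<^sub>1, z\<^sub>2]\<close> is specialized by the homomorphism \<open>E\<close> with \<open>y \<mapsto> u\<close> and \<open>z \<mapsto> v\<close>.
\<close>

lemma additive_poly_pt:
  assumes "additive_poly f"
  shows "pt (\<lambda>i. u i + v i) f = pt u f + pt v f"
proof -
  define E where "E G = pt u (pt (\<lambda>i. const2 (v i)) G)" for G :: "'a poly poly poly poly"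
  have E: "is_hom E"
    unfolding E_def by (rule is_hom_comp[OF is_hom_pt is_hom_pt])
  have E_val: "E (const2 (const2 c)) = c" "E (const2 (var i)) = u i" "E (var i) = v i" for c i
    by (simp_all add: E_def)
  have sub: "E (subst2 (\<lambda>c. const2 (const2 c)) w f) = pt (\<lambda>i. E (w i)) f" for w
    by (simp add: hom_subst2[OF E is_hom_const2_const2] E_val pt_def)
  show ?thesis
    using arg_cong[OF assms[unfolded additive_poly_def Let_def], of E]
    by (simp add: hom_add[OF E] sub E_val)
qed

lemma poly_eq_0_infinite:
  fixes p :: "'a::idom poly"
  assumes "infinite (UNIV :: 'a set)" "\<And>x. poly p x = 0"
  shows "p = 0"
  using poly_roots_finite[of p] assms by auto

lemma pt_eq_0_infinite:
  fixes f :: "'a::idom poly poly"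
  assumes inf: "infinite (UNIV :: 'a set)" and "\<And>u. pt u f = 0"
  shows "f = 0"
proof (rule poly_eqI)
  fix n
  have "poly (coeff f n) x = 0" for x
  proof -
    have "poly (map_poly (\<lambda>c. poly c x) f) y = 0" for y
      using assms(2)[of "\<lambda>i. if i = 1 then x else y"] by (simp add: pt_poly)
    then have "map_poly (\<lambda>c. poly c x) f = 0" by (rule poly_eq_0_infinite[OF inf])
    then show ?thesis by (metis coeff_0 coeff_map_poly poly_0)
  qed
  then show "coeff f n = coeff 0 n"
    using poly_eq_0_infinite[OF inf] by simp
qed

lemma ev_var1: "ev g (var 1) = [:g:]"
  by (induction g) (simp_all add: ev_pCons const2_def var_def)

lemma coeff_ev_var2: "coeff (ev g (var 2)) j = [:coeff g j:]"
  by (induction g arbitrary: j) (auto simp: ev_pCons const2_def var_def coeff_pCons split: nat.split)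

lemma coeff_ev_sum:
  "coeff (coeff (ev g (var 1 + var 2)) j) i = of_nat ((i + j) choose j) * coeff g (i + j)"
proof -
  have s: "var 1 + var 2 = [:[:0, 1:], 1 :: 'a poly:]" by (simp add: var_def)
  have x: "[:0, 1 :: 'a:] = monom 1 1" by (simp add: monom_Suc monom_0)
  have pw: "coeff (coeff ([:[:0, 1:], 1 :: 'a poly:] ^ n) j) i = (if n = i + j then of_nat (n choose j) else 0)" for n
  proof (cases "j \<le> n")
    case True
    then have "coeff ([:[:0, 1:], 1 :: 'a poly:] ^ n) j = of_nat (n choose j) * monom 1 (n - j)"
      by (simp add: coeff_linear_poly_power x monom_power)
    also have "\<dots> = monom (of_nat (n choose j)) (n - j)"
      by (simp add: of_nat_poly smult_monom)
    finally show ?thesis using True by auto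
  next
    case False
    moreover have "degree ([:[:0, 1:], 1 :: 'a poly:] ^ n) \<le> 1 * n"
      by (rule order_trans[OF degree_power_le]) simp
    ultimately show ?thesis by (simp add: coeff_eq_0)
  qed
  have "coeff (coeff (ev g (var 1 + var 2)) j) i
      = (\<Sum>n\<le>degree (map_poly const2 g). coeff g n * (if n = i + j then of_nat (n choose j) else 0))"
  proof -
    have "coeff (coeff (const2 c * F) j) i = c * coeff (coeff F j) i" for c and F :: "'a poly poly"
      by (simp add: const2_def)
    then show ?thesis
      by (simp add: ev_def poly_altdef s coeff_sum coeff_map_poly const2_simps pw del: mult_pCons_left)
  qed
  also have "\<dots> = (if i + j \<le> degree g then coeff g (i + j) * of_nat ((i + j) choose j) else 0)"
    by (simp add: degree_map_poly sum.delta if_distrib[of "\<lambda>x. _ * x"] cong: if_cong)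
  also have "\<dots> = of_nat ((i + j) choose j) * coeff g (i + j)"
    by (simp add: coeff_eq_0)
  finally show ?thesis .
qed

text \<open>
  If \<open>n = p\<^sup>k m\<close> with \<open>m\<close> prime to \<open>p\<close>, then \<open>p\<close> does not divide the binomial coefficient of \<open>n\<close> and \<open>p\<^sup>k\<close>.
\<close>

lemma prime_power_if_dvd_binomials:
  assumes p: "prime (p::nat)" and n: "n > 0" and dvd: "\<And>j. 0 < j \<Longrightarrow> j < n \<Longrightarrow> p dvd n choose j"
  shows "n \<in> range ((^) p)"
proof -
  obtain m where m: "n = p ^ multiplicity p n * m" "\<not> p dvd m"
    using multiplicity_decompose'[of n p] n p by (metis not_prime_unit less_irrefl)
  define k where "k = multiplicity p n"
  have nk: "n = p ^ k * m" using m(1) by (simp add: k_def)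
  have "m > 0" using n nk by (cases m) auto
  have "m = 1"
  proof (rule ccontr)
    assume "m \<noteq> 1"
    then have "p ^ k < n" using \<open>m > 0\<close> prime_gt_0_nat[OF p] by (simp add: nk)
    moreover have "0 < p ^ k" using prime_gt_0_nat[OF p] by simp
    ultimately have "p dvd p ^ k * m choose p ^ k" using dvd nk by metis
    moreover have "multiplicity p (p ^ k * m choose p ^ k) = 0"
      using const_p_fac[OF \<open>m > 0\<close> p, of k] m(2) by (simp add: not_dvd_imp_multiplicity_0)
    moreover have "p ^ k * m choose p ^ k \<noteq> 0"
      using \<open>p ^ k < n\<close> nk by simp
    ultimately show False
      using p by (metis multiplicity_eq_zero_iff not_prime_unit prime_elem_multiplicity_eq_zero_iff prime_imp_prime_elem)
  qed
  then show ?thesis using nk by simp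
qed

text \<open>
  Compare the coefficients of \<open>x\<^sub>1\<^sup>i x\<^sub>2\<^sup>j\<close> with \<open>i, j > 0\<close> in \<open>g(x\<^sub>1 + x\<^sub>2) = g(x\<^sub>1) + g(x\<^sub>2)\<close>.
\<close>

lemma additive_imp_linearized:
  fixes g :: "'a::idom poly"
  assumes inf: "infinite (UNIV :: 'a set)" and p: "prime CHAR('a)"
    and add: "\<And>x y. poly g (x + y) = poly g x + poly g y"
  shows "linearized CHAR('a) g"
  unfolding linearized_def
proof (intro allI impI)
  fix n
  assume n: "coeff g n \<noteq> 0"
  have "ev g (var 1 + var 2) - ev g (var 1) - ev g (var 2) = 0"
    by (rule pt_eq_0_infinite[OF inf]) (simp add: pt_simps pt_ev add)
  then have eq: "ev g (var 1 + var 2) = ev g (var 1) + ev g (var 2)" by (simp add: diff_eq_eq add.commute)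
  have "CHAR('a) dvd n choose j" if j: "0 < j" "j < n" for j
  proof -
    have "coeff (coeff (ev g (var 1 + var 2)) j) (n - j) = 0"
      using j by (simp add: eq ev_var1 coeff_ev_var2 coeff_pCons split: nat.splits)
    then have "of_nat (n choose j) * coeff g n = 0"
      using j by (simp add: coeff_ev_sum)
    then show ?thesis using n by (simp add: of_nat_eq_0_iff_char_dvd)
  qed
  moreover have "n > 0"
  proof (rule ccontr)
    assume "\<not> n > 0"
    then have "poly g 0 \<noteq> 0" using n by (simp add: poly_0_coeff_0)
    then show False using add[of 0 0] by (metis add.right_neutral add_cancel_right_right)
  qed
  ultimately show "n \<in> range ((^) CHAR('a))"
    by (intro prime_power_if_dvd_binomials[OF p]) blast+
qed

context frobenius_power
begin

text \<open>
  An additive function of two arguments is the sum of its restrictions to the two axes.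
\<close>

lemma additive_imp_split_form:
  fixes f :: "'a poly poly"
  assumes inf: "infinite (UNIV :: 'a set)" and s: "s = CHAR('a)" "prime s"
    and add: "\<And>u v. pt (\<lambda>i. u i + v i) f = pt u f + pt v f"
  shows "split_form f"
proof -
  define w where "w x y = (\<lambda>i::2. if i = 1 then x else y)" for x y :: 'a
  have w: "(\<lambda>i. w x y i + w x' y' i) = w (x + x') (y + y')" for x y x' y'
    by (auto simp: w_def)
  define g where "g = coeff f 0"
  define h where "h = map_poly (\<lambda>c. poly c 0) f"
  have g: "poly g x = pt (w x 0) f" for x
    by (simp add: g_def pt_poly w_def poly_0_coeff_0 coeff_map_poly)
  have h: "poly h x = pt (w 0 x) f" for x
    by (simp add: h_def pt_poly w_def)
  have p: "prime CHAR('a)" using s by simp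
  have "poly g (x + y) = poly g x + poly g y" for x y
    using add[of "w x 0" "w y 0", unfolded w] by (simp add: g)
  then have "linearized s g" unfolding s(1) by (rule additive_imp_linearized[OF inf p])
  moreover have "poly h (x + y) = poly h x + poly h y" for x y
    using add[of "w 0 x" "w 0 y", unfolded w] by (simp add: h)
  then have "linearized s h" unfolding s(1) by (rule additive_imp_linearized[OF inf p])
  moreover have "f - (ev g (var 1) + ev h (var 2)) = 0"
  proof (rule pt_eq_0_infinite[OF inf])
    fix u :: "2 \<Rightarrow> 'a"
    have "u = w (u 1) (u 2)" using exhaust_2 by (auto simp: w_def fun_eq_iff)
    then have "pt u f = pt (w (u 1) 0) f + pt (w 0 (u 2)) f"
      using add[of "w (u 1) 0" "w 0 (u 2)", unfolded w] by simp
    then show "pt u (f - (ev g (var 1) + ev h (var 2))) = 0"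
      by (simp add: pt_simps pt_ev g h)
  qed
  then have "f = ev g (var 1) + ev h (var 2) + const2 0" by (simp add: const2_simps)
  ultimately show ?thesis unfolding split_form_def by blast
qed

text \<open>
  An automorphism gives a bijection of the plane, whose inverse belongs to the inverse automorphism. The inverse of an
  additive bijection is additive.
\<close>

lemma Add2_subset_GAff:
  assumes inf: "infinite (UNIV :: 'a set)" and s: "s = CHAR('a)" "prime s"
  shows "Add2 \<subseteq> GAff"
proof
  fix \<phi> :: "'a endo2"
  assume "\<phi> \<in> Add2"
  then have \<phi>: "\<phi> \<in> carrier Aut2" and "additive_poly (\<phi> (var i))" for i
    using exhaust_2[of i] by (auto simp: Add2_def)
  then have add: "pt (\<lambda>i. u i + v i) (\<phi> (var i)) = pt u (\<phi> (var i)) + pt v (\<phi> (var i))" for u v i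
    by (intro additive_poly_pt)
  define \<psi> where "\<psi> = inv\<^bsub>Aut2\<^esub> \<phi>"
  have \<psi>: "\<psi> \<in> carrier Aut2" unfolding \<psi>_def by (rule Aut_inv_closed[OF \<phi>])
  define \<Phi> \<Psi> where "\<Phi> u = (\<lambda>i. pt u (\<phi> (var i)))" and "\<Psi> u = (\<lambda>i. pt u (\<psi> (var i)))" for u
  have inv: "\<Phi> (\<Psi> u) = u" "\<Psi> (\<Phi> u) = u" for u
    unfolding \<Phi>_def \<Psi>_def
    by (simp_all add: pt_Aut[OF \<phi>, symmetric] pt_Aut[OF \<psi>, symmetric] Aut_inv[OF \<phi>, folded \<psi>_def])
  have \<Phi>_add: "\<Phi> (\<lambda>i. u i + v i) = (\<lambda>i. \<Phi> u i + \<Phi> v i)" for u v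
    by (simp add: \<Phi>_def add)
  have "\<Psi> (\<lambda>i. u i + v i) = (\<lambda>i. \<Psi> u i + \<Psi> v i)" for u v
    using \<Phi>_add[of "\<Psi> u" "\<Psi> v"] inv by metis
  then have "pt (\<lambda>i. u i + v i) (\<psi> (var j)) = pt u (\<psi> (var j)) + pt v (\<psi> (var j))" for u v j
    unfolding \<Psi>_def by (metis (no_types))
  then show "\<phi> \<in> GAff"
    using \<phi> add additive_imp_split_form[OF inf s] by (simp add: GAff_def \<psi>_def)
qed

end

section \<open>Partial derivatives and the Jacobian\<close>

lemma map_poly_pderiv_pCons: "map_poly pderiv (pCons c f) = pCons (pderiv c) (map_poly pderiv f)"
  by (simp add: map_poly_pCons)

lemma map_poly_pderiv_add: "map_poly pderiv (f + g) = map_poly pderiv f + map_poly pderiv (g :: 'a::idom poly poly)"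
  by (rule poly_eqI) (simp add: coeff_map_poly pderiv_add)

lemma map_poly_pderiv_smult:
  "map_poly pderiv (smult c g) = smult (pderiv c) g + smult c (map_poly pderiv (g :: 'a::idom poly poly))"
  by (rule poly_eqI) (simp add: coeff_map_poly pderiv_mult mult.commute add.commute)

lemma map_poly_pderiv_mult:
  "map_poly pderiv (f * g) = map_poly pderiv f * g + f * map_poly pderiv (g :: 'a::idom poly poly)"
proof (induction f)
  case (pCons c f)
  have "map_poly pderiv (pCons 0 (f * g)) = pCons 0 (map_poly pderiv (f * g))"
    by (simp add: map_poly_pderiv_pCons)
  then show ?case
    by (simp add: map_poly_pderiv_add map_poly_pderiv_smult map_poly_pderiv_pCons pCons.IH algebra_simps)
qed simp

lemma partial_deriv_add: "partial_deriv i (f + g) = partial_deriv i f + partial_deriv i g"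
  by (simp add: partial_deriv_def map_poly_pderiv_add pderiv_add)

lemma partial_deriv_mult: "partial_deriv i (f * g) = partial_deriv i f * g + f * partial_deriv i g"
  by (simp add: partial_deriv_def map_poly_pderiv_mult pderiv_mult mult.commute add.commute)

lemma partial_deriv_const2 [simp]: "partial_deriv i (const2 c) = 0"
  by (simp add: partial_deriv_def const2_def map_poly_pderiv_pCons pderiv_pCons)

lemma partial_deriv_var: "partial_deriv i (var j) = (if i = j then 1 else 0)"
  using exhaust_2[of i] exhaust_2[of j]
  by (auto simp: partial_deriv_def var_def map_poly_pderiv_pCons pderiv_pCons one_pCons)

lemma partial_deriv_ev: "partial_deriv i (ev p F) = ev (pderiv p) F * partial_deriv i F"
  by (induction p) (simp_all add: ev_pCons pderiv_pCons partial_deriv_add partial_deriv_mult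
      partial_deriv_const2[of i 0, simplified const2_simps] algebra_simps const2_simps)

lemma chain_rule:
  assumes "\<phi> \<in> carrier Aut2"
  shows "partial_deriv j (\<phi> f) = \<phi> (partial_deriv 1 f) * partial_deriv j (\<phi> (var 1))
    + \<phi> (partial_deriv 2 f) * partial_deriv j (\<phi> (var 2))"
proof (induction f rule: poly2_induct)
  case (var i)
  show ?case using exhaust_2[of i] by (auto simp: partial_deriv_var Aut_simps[OF assms])
qed (simp_all add: Aut_simps[OF assms] Aut_const[OF assms] partial_deriv_add partial_deriv_mult algebra_simps)

text \<open>
  A \<open>2 \<times> 2\<close> matrix over a commutative ring is invertible exactly if its determinant is a unit; the inverse is given by the
  adjugate.
\<close>

lemma Affd2_iff:
  "\<phi> \<in> Affd2 \<longleftrightarrow> \<phi> \<in> carrier Aut2 \<and> (\<exists>a b c d. (a * d - b * c) dvd 1 \<and>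
    partial_deriv 1 (\<phi> (var 1)) = const2 a \<and> partial_deriv 2 (\<phi> (var 1)) = const2 b \<and>
    partial_deriv 1 (\<phi> (var 2)) = const2 c \<and> partial_deriv 2 (\<phi> (var 2)) = const2 d)"
  (is "_ \<longleftrightarrow> _ \<and> ?J")
proof -
  have "?J" if inv: "invertible M" and jac: "jacobian \<phi> = map_matrix const2 M" for M :: "'a^2^2"
  proof -
    obtain N where N: "M ** N = mat 1" using inv unfolding invertible_def by blast
    have MN: "M $ i $ 1 * N $ 1 $ k + M $ i $ 2 * N $ 2 $ k = (if i = k then 1 else 0)" for i k
      using arg_cong[OF N, of "\<lambda>X. X $ i $ k"] by (simp add: matrix_matrix_mult_def sum_2 mat_def)
    have "(M$1$1 * M$2$2 - M$1$2 * M$2$1) * (N$1$1 * N$2$2 - N$1$2 * N$2$1)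
      = (M$1$1 * N$1$1 + M$1$2 * N$2$1) * (M$2$1 * N$1$2 + M$2$2 * N$2$2)
        - (M$1$1 * N$1$2 + M$1$2 * N$2$2) * (M$2$1 * N$1$1 + M$2$2 * N$2$1)"
      by (simp add: algebra_simps)
    also have "\<dots> = 1" by (simp add: MN)
    finally have "(M$1$1 * M$2$2 - M$1$2 * M$2$1) dvd 1" by (metis dvd_triv_left)
    moreover have "partial_deriv j (\<phi> (var i)) = const2 (M $ i $ j)" for i j
      using arg_cong[OF jac, of "\<lambda>X. X $ i $ j"] by (simp add: jacobian_def map_matrix_def)
    ultimately show ?J by blast
  qed
  moreover have "\<exists>M :: 'a^2^2. invertible M \<and> jacobian \<phi> = map_matrix const2 M" if J: ?J
  proof -
    obtain a b c d where det: "(a * d - b * c) dvd 1"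
      and D: "partial_deriv 1 (\<phi> (var 1)) = const2 a" "partial_deriv 2 (\<phi> (var 1)) = const2 b"
        "partial_deriv 1 (\<phi> (var 2)) = const2 c" "partial_deriv 2 (\<phi> (var 2)) = const2 d"
      using J by blast
    obtain e where "(a * d - b * c) * e = 1" using det unfolding dvd_def by auto
    then have e: "a * (d * e) - b * (c * e) = 1" by (simp add: algebra_simps)
    define M :: "'a^2^2" where "M = vector [vector [a, b], vector [c, d]]"
    define N :: "'a^2^2" where "N = vector [vector [d * e, - (b * e)], vector [- (c * e), a * e]]"
    have "M ** N = mat 1" "N ** M = mat 1"
      using e by (auto simp: vec_eq_iff forall_2 matrix_matrix_mult_def sum_2 mat_def M_def N_def algebra_simps)
    then have "invertible M" unfolding invertible_def by blast
    moreover have "jacobian \<phi> = map_matrix const2 M"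
      by (simp add: vec_eq_iff forall_2 jacobian_def map_matrix_def D M_def)
    ultimately show ?thesis by blast
  qed
  ultimately show ?thesis unfolding Affd2_def by blast
qed

text \<open>
  By the chain rule the Jacobian of the inverse solves a linear system with constant coefficients and
  invertible determinant, so it is constant by Cramer's rule.
\<close>

lemma subgroup_Affd2: "subgroup Affd2 (Aut2 :: ('a::idom endo2) monoid)"
proof -
  interpret Aut: group "Aut2 :: 'a endo2 monoid" by (rule group_Aut2)
  show ?thesis
  proof (rule Aut.subgroupI)
    have "id \<in> (Affd2 :: 'a endo2 set)"
      unfolding Affd2_iff
      by (intro conjI exI[of _ 1] exI[of _ 0] Aut_id exI[of _ "0::'a"] exI[of _ "1::'a"])
        (simp_all add: partial_deriv_var const2_simps)
    then show "Affd2 \<noteq> ({} :: 'a endo2 set)" by blast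
    show "inv\<^bsub>Aut2\<^esub> \<phi> \<in> Affd2" if "\<phi> \<in> Affd2" for \<phi> :: "'a endo2"
    proof -
      obtain a b c d where \<phi>: "\<phi> \<in> carrier Aut2" and det: "(a * d - b * c) dvd 1"
        and D: "partial_deriv 1 (\<phi> (var 1)) = const2 a" "partial_deriv 2 (\<phi> (var 1)) = const2 b"
          "partial_deriv 1 (\<phi> (var 2)) = const2 c" "partial_deriv 2 (\<phi> (var 2)) = const2 d"
        using \<open>\<phi> \<in> Affd2\<close> unfolding Affd2_iff by blast
      obtain e where e: "(a * d - b * c) * e = 1" using det unfolding dvd_def by auto
      define \<psi> where "\<psi> = inv\<^bsub>Aut2\<^esub> \<phi>"
      have \<psi>: "\<psi> \<in> carrier Aut2" unfolding \<psi>_def by (rule Aut_inv_closed[OF \<phi>])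
      have 1: "const2 a * partial_deriv j (\<psi> (var 1)) + const2 b * partial_deriv j (\<psi> (var 2))
          = const2 (if j = 1 then 1 else 0)" for j
        using chain_rule[OF \<psi>, of j "\<phi> (var 1)", symmetric]
        by (simp add: Aut_inv[OF \<phi>, folded \<psi>_def] D Aut_const[OF \<psi>] partial_deriv_var const2_simps)
      have 2: "const2 c * partial_deriv j (\<psi> (var 1)) + const2 d * partial_deriv j (\<psi> (var 2))
          = const2 (if j = 2 then 1 else 0)" for j
        using chain_rule[OF \<psi>, of j "\<phi> (var 2)", symmetric]
        by (simp add: Aut_inv[OF \<phi>, folded \<psi>_def] D Aut_const[OF \<psi>] partial_deriv_var const2_simps)
      have cramer: "const2 ((a * d - b * c) * e) * u = const2 (e * (d * x - b * y))"
          "const2 ((a * d - b * c) * e) * v = const2 (e * (a * y - c * x))"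
        if "const2 a * u + const2 b * v = const2 x" "const2 c * u + const2 d * v = const2 y" for u v x y
        by (simp_all add: const2_simps that[symmetric] algebra_simps)
      have "partial_deriv j (\<psi> (var 1)) = const2 (e * (d * (if j = 1 then 1 else 0) - b * (if j = 2 then 1 else 0)))"
        "partial_deriv j (\<psi> (var 2)) = const2 (e * (a * (if j = 2 then 1 else 0) - c * (if j = 1 then 1 else 0)))" for j
        using cramer[OF 1[of j] 2[of j]] by (simp_all only: e const2_simps(1) mult_1)
      note D' = this[of 1] this[of 2]
      have "(e * d) * (e * a) - (e * (- b)) * (e * (- c)) = (a * d - b * c) * e * e"
        by (simp add: algebra_simps)
      then have "((e * d) * (e * a) - (e * (- b)) * (e * (- c))) dvd 1"
        using e by (metis dvd_triv_right mult_1)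
      then show ?thesis
        unfolding Affd2_iff \<psi>_def[symmetric] using \<psi> D'
        by (intro conjI exI[of _ "e * d"] exI[of _ "e * (- b)"] exI[of _ "e * (- c)"] exI[of _ "e * a"]) simp_all
    qed
    show "\<phi> \<otimes>\<^bsub>Aut2\<^esub> \<psi> \<in> Affd2" if "\<phi> \<in> Affd2" "\<psi> \<in> Affd2" for \<phi> \<psi> :: "'a endo2"
    proof -
      obtain a b c d where \<phi>: "\<phi> \<in> carrier Aut2" and det: "(a * d - b * c) dvd 1"
        and D: "partial_deriv 1 (\<phi> (var 1)) = const2 a" "partial_deriv 2 (\<phi> (var 1)) = const2 b"
          "partial_deriv 1 (\<phi> (var 2)) = const2 c" "partial_deriv 2 (\<phi> (var 2)) = const2 d"
        using \<open>\<phi> \<in> Affd2\<close> unfolding Affd2_iff by blast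
      obtain a' b' c' d' where \<psi>: "\<psi> \<in> carrier Aut2" and det': "(a' * d' - b' * c') dvd 1"
        and D': "partial_deriv 1 (\<psi> (var 1)) = const2 a'" "partial_deriv 2 (\<psi> (var 1)) = const2 b'"
          "partial_deriv 1 (\<psi> (var 2)) = const2 c'" "partial_deriv 2 (\<psi> (var 2)) = const2 d'"
        using \<open>\<psi> \<in> Affd2\<close> unfolding Affd2_iff by blast
      have "(a' * a + b' * c) * (c' * b + d' * d) - (a' * b + b' * d) * (c' * a + d' * c)
        = (a' * d' - b' * c') * (a * d - b * c)"
        by (simp add: algebra_simps)
      then have "((a' * a + b' * c) * (c' * b + d' * d) - (a' * b + b' * d) * (c' * a + d' * c)) dvd 1"
        using mult_dvd_mono[OF det' det] by simp
      then show ?thesis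
        unfolding Affd2_iff using \<phi> \<psi>
        by (intro conjI exI[of _ "a' * a + b' * c"] exI[of _ "a' * b + b' * d"] exI[of _ "c' * a + d' * c"] exI[of _ "c' * b + d' * d"])
          (simp_all add: Aut_comp chain_rule[OF \<phi>, of _ "\<psi> _"] D D' Aut_const[OF \<phi>] const2_simps)
    qed
  qed (auto simp: Affd2_iff)
qed

context frobenius_power
begin

text \<open>
  A monomial of degree \<open>s ^ k\<close> has derivative zero unless its degree is 1, because the other powers of \<open>s\<close> are multiples of the
  characteristic.
\<close>

lemma partial_deriv_split_form:
  assumes "split_form F"
  shows "\<exists>k. partial_deriv j F = const2 k"
proof -
  have pd: "pderiv a = [:coeff a 1:]" if lin: "linearized s a" for a :: "'a poly"
  proof (rule poly_eqI)
    fix n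
    show "coeff (pderiv a) n = coeff [:coeff a 1:] n"
    proof (cases n)
      case (Suc m)
      have "of_nat (Suc n) * coeff a (Suc n) = 0"
      proof (cases "coeff a (Suc n) = 0")
        case False
        then obtain k where k: "Suc n = s ^ k" using lin by (auto simp: linearized_def)
        then have "k > 0" "s \<noteq> 1" using Suc by (cases k; auto)+
        then have "CHAR('a) dvd Suc n" using frob k by simp
        then have "(of_nat (Suc n) :: 'a) = 0" by (simp only: of_nat_eq_0_iff_char_dvd)
        from arg_cong[OF this, of "\<lambda>x. x * coeff a (Suc n)"] show ?thesis
          by (simp only: mult_zero_left)
      qed simp
      then show ?thesis using Suc by (simp add: coeff_pderiv)
    qed (simp add: coeff_pderiv)
  qed
  obtain a b c where "linearized s a" "linearized s b" "F = ev a (var 1) + ev b (var 2) + const2 c"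
    using assms by (rule split_formE)
  then have "partial_deriv j F = const2 (coeff a 1 * (if j = 1 then 1 else 0) + coeff b 1 * (if j = 2 then 1 else 0))"
    by (simp add: partial_deriv_add partial_deriv_ev pd partial_deriv_var const2_simps)
  then show ?thesis by blast
qed

text \<open>
  Both an element of \<open>GAff\<close> and its inverse have constant Jacobians, and these are inverse to each other by the chain rule.
\<close>

lemma GAff_subset_Affd2: "GAff \<subseteq> Affd2"
proof
  fix \<phi>
  assume \<phi>G: "\<phi> \<in> GAff"
  then have \<phi>: "\<phi> \<in> carrier Aut2" by (rule GAff_Aut)
  define \<psi> where "\<psi> = inv\<^bsub>Aut2\<^esub> \<phi>"
  have "\<forall>i j. \<exists>k. partial_deriv j (\<phi> (var i)) = const2 k" "\<forall>i j. \<exists>k. partial_deriv j (\<psi> (var i)) = const2 k"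
    using partial_deriv_split_form \<phi>G by (simp_all add: GAff_def \<psi>_def)
  then obtain A B where A: "\<And>i j. partial_deriv j (\<phi> (var i)) = const2 (A i j)"
    and B: "\<And>i j. partial_deriv j (\<psi> (var i)) = const2 (B i j)"
    by metis
  have BA: "B i 1 * A 1 j + B i 2 * A 2 j = (if j = i then 1 else 0)" for i j
  proof -
    have "const2 (B i 1 * A 1 j + B i 2 * A 2 j) = const2 (if j = i then 1 else 0)"
      using chain_rule[OF \<phi>, of j "\<psi> (var i)", symmetric]
      by (simp add: Aut_inv[OF \<phi>, folded \<psi>_def] A B Aut_const[OF \<phi>] partial_deriv_var const2_simps)
    then show ?thesis by (simp only: const2_inject)
  qed
  have "(A 1 1 * A 2 2 - A 1 2 * A 2 1) * (B 1 1 * B 2 2 - B 1 2 * B 2 1)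
    = (B 1 1 * A 1 1 + B 1 2 * A 2 1) * (B 2 1 * A 1 2 + B 2 2 * A 2 2)
      - (B 1 1 * A 1 2 + B 1 2 * A 2 2) * (B 2 1 * A 1 1 + B 2 2 * A 2 1)"
    by (simp add: algebra_simps)
  also have "\<dots> = 1" by (simp add: BA)
  finally have "(A 1 1 * A 2 2 - A 1 2 * A 2 1) dvd 1" by (metis dvd_triv_left)
  then show "\<phi> \<in> Affd2" unfolding Affd2_iff using \<phi> A by blast
qed

end

lemma Aff2_subset_Affd2: "Aff2 \<subseteq> (Affd2 :: 'a::idom endo2 set)"
proof -
  interpret frobenius_power 1 "TYPE('a)" by unfold_locales simp
  show ?thesis using Aff2_subset_GAff GAff_subset_Affd2 by blast
qed

section \<open>Columns of Jacobian matrices\<close>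

text \<open>
  By the chain rule, right multiplication by an automorphism with constant Jacobian multiplies a column of the Jacobian
  by an invertible constant matrix, and a shear multiplies it by an elementary matrix. The first column
  thus turns questions about \<open>Td2\<close> into questions about products of such matrices, which are again answered by the ping-pong
  principle, now with ordinary degrees.
\<close>

type_synonym 'a column = "'a poly poly \<times> 'a poly poly"

definition linear_col :: "'a::idom \<Rightarrow> 'a \<Rightarrow> 'a \<Rightarrow> 'a \<Rightarrow> 'a column \<Rightarrow> 'a column"
  where "linear_col a b c d = (\<lambda>(x, y). (const2 a * x + const2 b * y, const2 c * x + const2 d * y))"

definition shear_col :: "'a::idom poly poly \<Rightarrow> 'a column \<Rightarrow> 'a column"
  where "shear_col f = (\<lambda>(x, y). (x, y + f * x))"

definition linear_cols :: "('a::idom column \<Rightarrow> 'a column) set"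
  where "linear_cols = {linear_col a b c d |a b c d. (a * d - b * c) dvd 1}"

definition triang_cols :: "('a::idom column \<Rightarrow> 'a column) set"
  where "triang_cols = {linear_col a 0 c d |a c d. (a * d) dvd 1}"

definition const_cols :: "'a::idom column set"
  where "const_cols = {(const2 x, const2 y) |x y. True}"

definition steep :: "'a::idom column \<Rightarrow> bool"
  where "steep v \<longleftrightarrow> tdeg (fst v) < tdeg (snd v)"

text \<open>
  A column with vanishing first entry is not changed by a shear, so a shear acts properly only
  if the first entry is nonzero and the factor \<open>f\<close> is not constant; then it turns a column that is not steep into a steep one.
\<close>

lemma ping_pong_columns:
  "ping_pong UNIV const_cols linear_cols (range shear_col) triang_cols (steep :: 'a::idom column \<Rightarrow> bool)"
proof (rule ping_pong.intro)
  have lin: "linear_col a b c d \<in> linear_cols" if "(a * d - b * c) dvd 1" for a b c d :: 'a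
    using that by (auto simp: linear_cols_def)
  have id_eq: "id = linear_col 1 0 0 (1::'a)"
    by (simp add: linear_col_def fun_eq_iff const2_simps)
  show "\<not> steep v" if "v \<in> const_cols" for v :: "'a column"
    using that by (auto simp: const_cols_def steep_def)
  show "g ` const_cols \<subseteq> const_cols" if g: "g \<in> linear_cols" for g :: "'a column \<Rightarrow> 'a column"
  proof -
    obtain a b c d where "g = linear_col a b c d" using g by (auto simp: linear_cols_def)
    then show ?thesis
      by (auto simp: linear_col_def const_cols_def const2_simps(2,3)[symmetric] simp del: const2_inject)
  qed
  show "id \<in> (linear_cols :: ('a column \<Rightarrow> _) set)"
    unfolding id_eq by (rule lin) simp
  show "g \<circ> h \<in> linear_cols" if gh: "g \<in> linear_cols" "h \<in> linear_cols" for g h :: "'a column \<Rightarrow> 'a column"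
  proof -
    obtain a b c d where g: "g = linear_col a b c d" "(a * d - b * c) dvd 1"
      using gh(1) by (auto simp: linear_cols_def)
    obtain a' b' c' d' where h: "h = linear_col a' b' c' d'" "(a' * d' - b' * c') dvd 1"
      using gh(2) by (auto simp: linear_cols_def)
    have "g \<circ> h = linear_col (a * a' + b * c') (a * b' + b * d') (c * a' + d * c') (c * b' + d * d')"
      by (simp add: g h linear_col_def fun_eq_iff const2_simps algebra_simps)
    moreover have "(a * a' + b * c') * (c * b' + d * d') - (a * b' + b * d') * (c * a' + d * c')
        = (a * d - b * c) * (a' * d' - b' * c')"
      by (simp add: algebra_simps)
    then have "((a * a' + b * c') * (c * b' + d * d') - (a * b' + b * d') * (c * a' + d * c')) dvd 1"
      using mult_dvd_mono[OF g(2) h(2)] by simp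
    ultimately show ?thesis using lin by metis
  qed
  show "g \<circ> h \<in> range shear_col" if gh: "g \<in> range shear_col" "h \<in> range shear_col" for g h :: "'a column \<Rightarrow> 'a column"
  proof -
    obtain f f' where "g = shear_col f" "h = shear_col f'" using gh by blast
    then have "g \<circ> h = shear_col (f + f')" by (simp add: shear_col_def fun_eq_iff algebra_simps)
    then show ?thesis by blast
  qed
  show "steep (g v) \<or> (\<exists>h\<in>linear_cols. g v = h v)" if g: "g \<in> range shear_col" and v: "\<not> steep v" for v and g :: "'a column \<Rightarrow> 'a column"
  proof -
    obtain f where f: "g = shear_col f" using g by blast
    obtain x y where xy: "v = (x, y)" by fastforce
    consider "x = 0" | k where "f = const2 k" | "x \<noteq> 0" "tdeg f > 0"
      using tdeg_eq_0_iff by blast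
    then show ?thesis
    proof cases
      case 1
      then have "g v = id v" by (simp add: f xy shear_col_def)
      moreover have "id \<in> (linear_cols :: ('a column \<Rightarrow> _) set)" unfolding id_eq by (rule lin) simp
      ultimately show ?thesis by blast
    next
      case 2
      then have "g v = linear_col 1 0 k 1 v" by (simp add: f xy shear_col_def linear_col_def const2_simps)
      moreover have "linear_col 1 0 k 1 \<in> linear_cols" by (rule lin) simp
      ultimately show ?thesis by blast
    next
      case 3
      then have "f \<noteq> 0" by auto
      then have "tdeg (f * x) = tdeg f + tdeg x" using 3 by (simp add: tdeg_mult)
      moreover have "tdeg y \<le> tdeg x" using v by (simp add: steep_def xy)
      ultimately have "tdeg (y + f * x) = tdeg f + tdeg x" using 3 by (simp add: tdeg_add_eq_right)
      then show ?thesis using 3 by (simp add: f xy shear_col_def steep_def)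
    qed
  qed
  show "g \<in> triang_cols" if g: "g \<in> linear_cols" and st: "steep v" "steep (g v)" for v and g :: "'a column \<Rightarrow> 'a column"
  proof -
    obtain a b c d where abcd: "g = linear_col a b c d" "(a * d - b * c) dvd 1"
      using g by (auto simp: linear_cols_def)
    obtain x y where xy: "v = (x, y)" by fastforce
    have lt: "tdeg x < tdeg y" using st(1) by (simp add: steep_def xy)
    have "b = 0"
    proof (rule ccontr)
      assume "b \<noteq> 0"
      then have "tdeg (const2 a * x) < tdeg (const2 b * y)"
        using lt tdeg_const_mult_le[of a x] by simp
      then have "tdeg (const2 a * x + const2 b * y) = tdeg y"
        using \<open>b \<noteq> 0\<close> by (simp add: tdeg_add_eq_right)
      moreover have "tdeg (const2 c * x + const2 d * y) \<le> tdeg y"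
        using lt tdeg_const_mult_le[of c x] tdeg_const_mult_le[of d y] by (intro tdeg_add_le) simp_all
      ultimately show False using st(2) by (simp add: steep_def xy abcd linear_col_def)
    qed
    then show ?thesis using abcd by (auto simp: triang_cols_def)
  qed
  show "\<exists>b'\<in>range shear_col. \<exists>g'\<in>linear_cols. \<forall>v\<in>UNIV. (b \<circ> g) v = (g' \<circ> b') v"
    if g: "g \<in> triang_cols" and b: "b \<in> range shear_col" for g b :: "'a column \<Rightarrow> 'a column"
  proof -
    obtain a c d where acd: "g = linear_col a 0 c d" "(a * d) dvd 1"
      using g by (auto simp: triang_cols_def)
    obtain f where f: "b = shear_col f" using b by blast
    obtain e where e: "d * (e * a) = 1" using acd(2) unfolding dvd_def by (metis mult.assoc mult.commute)
    have "const2 d * (const2 (e * a * a) * f * x) = const2 (d * (e * a) * a) * f * x" for x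
      by (simp add: const2_simps mult.assoc)
    then have "const2 d * (const2 (e * a * a) * f * x) = const2 a * f * x" for x
      by (simp only: e mult_1)
    then have "(b \<circ> g) v = (g \<circ> shear_col (const2 (e * a * a) * f)) v" for v
      by (cases v) (simp add: f acd linear_col_def shear_col_def distrib_left mult.commute mult.left_commute const2_simps)
    moreover have "g \<in> linear_cols" unfolding acd by (rule lin) (use acd in simp)
    ultimately show ?thesis by blast
  qed
qed simp_all

text \<open>
  The analogue of the criterion for \<open>Tg2\<close>. The degree hypothesis says that the first column \<open>(x, y)\<close> satisfies
  \<open>y = - (g / a) x\<close> up to low degree. The last elementary matrix of a word for \<open>\<phi>\<close> would have to
  cancel \<open>g / a\<close> up to units and constants, which is impossible over the polynomial ring unless \<open>g\<close> is constant modulo \<open>a\<close>.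
\<close>

lemma outside_Td2:
  fixes \<phi> :: "'a::idom endo2"
  assumes \<phi>: "\<phi> \<in> carrier Aut2" and a: "a \<noteq> 0"
    and g: "\<nexists>c h. g = const2 c + const2 a * h"
    and nz: "partial_deriv 1 (\<phi> (var 1)) \<noteq> 0"
    and le: "tdeg (const2 a * partial_deriv 1 (\<phi> (var 2)) + g * partial_deriv 1 (\<phi> (var 1)))
      \<le> tdeg (partial_deriv 1 (\<phi> (var 1)))"
  shows "\<phi> \<notin> Td2"
proof
  assume Td2: "\<phi> \<in> Td2"
  interpret ping_pong UNIV const_cols linear_cols "range shear_col" triang_cols "steep :: 'a column \<Rightarrow> bool"
    by (rule ping_pong_columns)
  define col where "col \<phi> = (partial_deriv 1 (\<phi> (var 1)), partial_deriv 1 (\<phi> (var 2)))" for \<phi> :: "'a endo2"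
  have "generate Aut2 (Affd2 \<union> T2) \<subseteq> {\<phi> \<in> carrier Aut2. col \<phi> \<in> reach}"
  proof (rule generated_subset[OF subgroup_Affd2 Aff2_subset_Affd2])
    have "col id = (const2 1, const2 0)" by (simp add: col_def partial_deriv_var const2_simps)
    then have "col id \<in> const_cols" by (auto simp: const_cols_def)
    then show "id \<in> {\<phi> \<in> carrier Aut2. col \<phi> \<in> reach}" by (simp add: Aut_id reach.start)
    show "\<phi> \<circ> \<alpha> \<in> {\<phi> \<in> carrier Aut2. col \<phi> \<in> reach}"
      if "\<phi> \<in> {\<phi> \<in> carrier Aut2. col \<phi> \<in> reach}" and \<alpha>: "\<alpha> \<in> Affd2" for \<phi> \<alpha>
    proof -
      have \<phi>: "\<phi> \<in> carrier Aut2" "col \<phi> \<in> reach" using that(1) by simp_all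
      obtain a b c d where \<alpha>A: "\<alpha> \<in> carrier Aut2" and det: "(a * d - b * c) dvd 1"
        and D: "partial_deriv 1 (\<alpha> (var 1)) = const2 a" "partial_deriv 2 (\<alpha> (var 1)) = const2 b"
          "partial_deriv 1 (\<alpha> (var 2)) = const2 c" "partial_deriv 2 (\<alpha> (var 2)) = const2 d"
        using \<alpha> unfolding Affd2_iff by blast
      have "col (\<phi> \<circ> \<alpha>) = linear_col a b c d (col \<phi>)"
        by (simp add: col_def linear_col_def chain_rule[OF \<phi>(1), of _ "\<alpha> _"] D Aut_const[OF \<phi>(1)])
      moreover have "linear_col a b c d \<in> linear_cols" using det by (auto simp: linear_cols_def)
      ultimately show ?thesis using reach_A[OF \<phi>(2)] \<phi>(1) \<alpha>A by (simp add: Aut_comp)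
    qed
    show "\<phi> \<circ> shear f \<in> {\<phi> \<in> carrier Aut2. col \<phi> \<in> reach}"
      if "\<phi> \<in> {\<phi> \<in> carrier Aut2. col \<phi> \<in> reach}" for \<phi> f
    proof -
      have \<phi>: "\<phi> \<in> carrier Aut2" "col \<phi> \<in> reach" using that by simp_all
      have "col (\<phi> \<circ> shear f) = shear_col (ev (pderiv f) (\<phi> (var 1))) (col \<phi>)"
        by (simp add: col_def shear_col_def hom_add[OF Aut_hom[OF \<phi>(1)]] Aut_ev[OF \<phi>(1)]
            partial_deriv_add partial_deriv_ev)
      then show ?thesis using reach_B[OF \<phi>(2) rangeI] \<phi>(1) by (simp add: Aut_comp shear_Aut)
    qed
  qed
  then have reach: "col \<phi> \<in> reach" using Td2 unfolding Td2_def by blast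
  define x y where xy: "x = partial_deriv 1 (\<phi> (var 1))" "y = partial_deriv 1 (\<phi> (var 2))"
  have col: "col \<phi> = (x, y)" by (simp add: col_def xy)
  have nonconst: "tdeg k > 0" if "\<nexists>c h. k = const2 c + const2 a * h" for k
  proof (rule ccontr)
    assume "\<not> tdeg k > 0"
    then obtain c where "k = const2 c" using tdeg_eq_0_iff by blast
    then have "k = const2 c + const2 a * 0" by simp
    then show False using that by blast
  qed
  have g0: "tdeg g > 0" using g by (rule nonconst)
  then have "g \<noteq> 0" by auto
  then have dg: "tdeg (g * x) = tdeg g + tdeg x" using nz by (simp add: tdeg_mult xy)
  have "steep (col \<phi>)"
  proof -
    have "tdeg (const2 a * y + g * x) < tdeg (- (g * x))"
      using le dg g0 by (simp add: xy)
    then have "tdeg ((const2 a * y + g * x) + (- (g * x))) = tdeg (- (g * x))"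
      by (rule tdeg_add_eq_right)
    then have "tdeg y = tdeg g + tdeg x" using a dg by simp
    then show ?thesis using g0 by (simp add: col steep_def)
  qed
  then obtain w p q where w: "w \<in> reach" "\<not> steep w" and pq: "q \<in> range shear_col" "p \<in> triang_cols" "col \<phi> = (p \<circ> q) w"
    by (rule reach_P[OF reach])
  obtain f where f: "q = shear_col f" using pq(1) by blast
  obtain u c d where u: "p = linear_col u 0 c d" "(u * d) dvd 1" using pq(2) by (auto simp: triang_cols_def)
  obtain w1 w2 where w12: "w = (w1, w2)" by fastforce
  have x: "x = const2 u * w1" and y: "y = const2 c * w1 + const2 d * (w2 + f * w1)"
    using pq(3) by (simp_all add: col f u w12 linear_col_def shear_col_def const2_simps)
  obtain u' where u': "u' * u = 1" using u(2) unfolding dvd_def by (metis mult.assoc mult.commute)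
  then have "u \<noteq> 0" by auto
  then have w1: "w1 \<noteq> 0" "tdeg w1 = tdeg x" using nz by (auto simp: x xy[symmetric])
  define k where "k = g * const2 u + const2 a * (const2 c + const2 d * f)"
  have "\<nexists>e h. k = const2 e + const2 a * h"
  proof
    assume "\<exists>e h. k = const2 e + const2 a * h"
    then obtain e h where k: "k = const2 e + const2 a * h" by blast
    have "g = const2 (u' * u) * g" by (simp add: u' const2_simps)
    also have "\<dots> = const2 u' * (g * const2 u)" by (simp add: const2_simps mult_ac)
    also have "g * const2 u = const2 e + const2 a * h - const2 a * (const2 c + const2 d * f)"
      using k by (simp add: k_def algebra_simps)
    also have "const2 u' * \<dots> = const2 (u' * e) + const2 a * (const2 u' * (h - (const2 c + const2 d * f)))"
      by (simp add: const2_simps algebra_simps)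
    finally show False using g by blast
  qed
  then have k: "tdeg k > 0" by (rule nonconst)
  then have "k \<noteq> 0" by auto
  then have dk: "tdeg (k * w1) = tdeg k + tdeg w1" using w1 by (simp add: tdeg_mult)
  have "tdeg (const2 (a * d) * w2) \<le> tdeg w1"
    using w(2) tdeg_const_mult_le[of "a * d" w2] by (simp add: steep_def w12)
  then have "tdeg (const2 (a * d) * w2 + k * w1) = tdeg k + tdeg w1"
    using dk k by (simp add: tdeg_add_eq_right)
  moreover have "const2 (a * d) * w2 + k * w1 = const2 a * y + g * x"
    by (simp add: x y k_def const2_simps algebra_simps)
  ultimately show False using le k w1 by (simp add: xy)
qed

section \<open>The wild automorphisms\<close>

text \<open>
  Let \<open>\<tau>\<close> be the shear \<open>x\<^sub>2 \<mapsto> x\<^sub>2 + x\<^sub>1\<^sup>m / a\<close> over the fraction field. The automorphisms \<open>wild c\<close> are the conjugates by \<open>\<tau>\<close> of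
  the linear maps \<open>x\<^sub>1 \<mapsto> x\<^sub>1 + c a\<^sup>2 x\<^sub>2\<close>, and so they form a one-parameter group. They fix \<open>a \<tau>(x\<^sub>2) = a x\<^sub>2 + x\<^sub>1\<^sup>m\<close>.
  The factor \<open>a\<^sup>2\<close> is what keeps their coefficients in the domain: \<open>wild1\<^sup>m - x\<^sub>1\<^sup>m\<close> is divisible by \<open>a\<close>, and the quotient
  is written out in \<open>wild2\<close>.
\<close>

context
  fixes a :: "'a::idom" and m :: nat
begin

definition wild_invariant :: "'a poly poly"
  where "wild_invariant = const2 a * var 2 + var 1 ^ m"

definition wild1 :: "'a \<Rightarrow> 'a poly poly"
  where "wild1 c = var 1 + const2 (c * a) * wild_invariant"

definition wild2 :: "'a \<Rightarrow> 'a poly poly"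
  where "wild2 c = var 2 - const2 c * wild_invariant * (\<Sum>i<m. var 1 ^ (m - Suc i) * wild1 c ^ i)"

definition wild :: "'a \<Rightarrow> 'a endo2"
  where "wild c = endo (wild1 c) (wild2 c)"

lemma wild2_eq: "const2 a * wild2 c + wild1 c ^ m = wild_invariant"
proof -
  have "wild1 c ^ m - var 1 ^ m = const2 (c * a) * wild_invariant * (\<Sum>i<m. var 1 ^ (m - Suc i) * wild1 c ^ i)"
    by (subst power_diff_sumr2) (simp add: wild1_def)
  then have "const2 a * wild2 c + (wild1 c ^ m - var 1 ^ m) = const2 a * var 2"
    by (simp add: wild2_def const2_simps algebra_simps)
  then show ?thesis by (simp add: wild_invariant_def algebra_simps)
qed

lemma wild_invariant_fixed: "wild c wild_invariant = wild_invariant"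
proof -
  have "wild c wild_invariant = const2 a * wild2 c + wild1 c ^ m"
    unfolding wild_invariant_def by (simp add: wild_def endo_simps)
  then show ?thesis by (simp only: wild2_eq)
qed

lemma wild_wild1: "wild c (wild1 d) = wild1 (c + d)"
proof -
  have "wild c (wild1 d) = wild1 c + const2 (d * a) * wild c wild_invariant"
    unfolding wild1_def[of d] by (simp add: wild_def endo_simps)
  then show ?thesis
    by (simp add: wild_invariant_fixed wild1_def const2_simps algebra_simps)
qed

text \<open>
  Multiplied by \<open>a\<close>, the claim follows from the invariance of \<open>a x\<^sub>2 + x\<^sub>1\<^sup>m\<close>; so \<open>a\<close> can be cancelled.
\<close>

lemma wild_wild2:
  assumes "a \<noteq> 0"
  shows "wild c (wild2 (- c)) = var 2"
proof -
  have "const2 a * wild c (wild2 (- c)) + wild c (wild1 (- c)) ^ m = wild c wild_invariant"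
    by (subst wild2_eq[symmetric, of "- c"]) (simp add: wild_def endo_simps)
  then have "const2 a * wild c (wild2 (- c)) + var 1 ^ m = const2 a * var 2 + var 1 ^ m"
    by (simp add: wild_wild1 wild_invariant_fixed, simp add: wild1_def wild_invariant_def const2_simps)
  then show ?thesis using assms by simp
qed

lemma wild_Aut: "a \<noteq> 0 \<Longrightarrow> wild c \<in> carrier Aut2"
  using wild_wild1[of c "- c"] wild_wild2[of c] wild_wild1[of "- c" c] wild_wild2[of "- c"]
  unfolding wild_def
  by (intro endo_in_Aut(1)[where F' = "wild1 (- c)" and G' = "wild2 (- c)"])
    (simp_all add: wild1_def const2_simps)

lemma inv_wild:
  assumes "a \<noteq> 0"
  shows "inv\<^bsub>Aut2\<^esub> (wild c) = wild (- c)"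
proof (rule Aut_inv_eqI[OF wild_Aut[OF assms]])
  have "wild c \<circ> wild (- c) = id"
  proof (rule Aut_eqI)
    show "(wild c \<circ> wild (- c)) (var 1) = id (var 1)"
      using wild_wild1[of c "- c"] by (simp add: wild_def wild1_def[of 0] const2_simps)
    show "(wild c \<circ> wild (- c)) (var 2) = id (var 2)"
      using wild_wild2[OF assms, of c] by (simp add: wild_def)
  qed (simp_all add: Aut_comp Aut_id wild_Aut assms)
  then show "wild c (wild (- c) f) = f" for f by (simp add: fun_eq_iff)
qed

text \<open>
  The shear \<open>x\<^sub>2 \<mapsto> x\<^sub>2 + x\<^sub>1\<close> commutes with \<open>\<tau>\<close>, so \<open>wild_conj\<close> is again conjugate by \<open>\<tau>\<close> to a linear map, and
  its last shear over the fraction field is essentially \<open>- x\<^sub>1\<^sup>m / a\<close>.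
\<close>

definition wild_conj :: "'a endo2"
  where "wild_conj = wild 1 \<circ> shear [:0, 1:] \<circ> wild (- 1)"

lemma wild_conj_Aut: "a \<noteq> 0 \<Longrightarrow> wild_conj \<in> carrier Aut2"
  unfolding wild_conj_def by (intro Aut_comp wild_Aut shear_Aut)

lemma shear_wild_invariant: "shear [:0, 1:] wild_invariant = wild_invariant + const2 a * var 1"
  by (simp add: wild_invariant_def shear_hom algebra_simps)

lemma wild_hom: "a \<noteq> 0 \<Longrightarrow> is_hom (wild c)"
  by (rule Aut_hom[OF wild_Aut])

lemma wild_conj_var1:
  assumes "a \<noteq> 0"
  shows "wild_conj (var 1) = const2 (1 - a ^ 2) * var 1 - const2 (a ^ 3) * wild_invariant"
proof -
  note [simp] = hom_simps[OF wild_hom[OF assms, of 1]] Aut_const[OF wild_Aut[OF assms, of 1]]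
  have "wild_conj (var 1) = wild 1 (shear [:0, 1:] (var 1 + const2 (- a) * wild_invariant))"
    by (simp add: wild_conj_def, simp add: wild_def wild1_def)
  also have "\<dots> = wild 1 (var 1 - const2 a * (wild_invariant + const2 a * var 1))"
    by (simp add: shear_hom shear_wild_invariant const2_simps)
  also have "\<dots> = wild1 1 - const2 a * (wild_invariant + const2 a * wild1 1)"
    by (simp add: wild_invariant_fixed, simp add: wild_def)
  also have "\<dots> = const2 (1 - a ^ 2) * var 1 - const2 (a ^ 3) * wild_invariant"
    by (simp add: wild1_def const2_simps algebra_simps power2_eq_square power3_eq_cube)
  finally show ?thesis .
qed

lemma wild_conj_relation:
  assumes "a \<noteq> 0"
  shows "const2 a * wild_conj (var 2) + wild_conj (var 1) ^ m = const2 (1 + a ^ 2) * wild_invariant + const2 a * var 1"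
proof -
  note hom = Aut_hom[OF wild_conj_Aut[OF assms]]
  note [simp] = hom_simps[OF wild_hom[OF assms, of 1]] Aut_const[OF wild_Aut[OF assms, of 1]]
  have "const2 a * wild_conj (var 2) + wild_conj (var 1) ^ m = wild_conj wild_invariant"
    by (simp add: wild_invariant_def hom_simps[OF hom] Aut_const[OF wild_conj_Aut[OF assms]])
  also have "\<dots> = wild 1 (wild_invariant + const2 a * var 1)"
    by (simp add: wild_conj_def wild_invariant_fixed shear_wild_invariant)
  also have "\<dots> = wild_invariant + const2 a * wild1 1"
    by (simp add: wild_invariant_fixed, simp add: wild_def)
  also have "\<dots> = const2 (1 + a ^ 2) * wild_invariant + const2 a * var 1"
    by (simp add: wild1_def const2_simps algebra_simps power2_eq_square)
  finally show ?thesis .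
qed

lemma tdeg_wild_invariant:
  assumes "m > 1"
  shows "tdeg wild_invariant = m"
proof -
  have "tdeg (const2 a * var 2) < tdeg (var 1 ^ m :: 'a poly poly)"
    using assms tdeg_const_mult_le[of a "var 2"] by (simp add: tdeg_power)
  then show ?thesis
    unfolding wild_invariant_def by (simp add: tdeg_add_eq_right tdeg_power)
qed

lemma tdeg_wild_conj:
  assumes "m > 1" "a \<noteq> 0"
  shows "tdeg (const2 a * wild_conj (var 2) + wild_conj (var 1) ^ m) \<le> tdeg (wild_conj (var 1))"
proof -
  have "tdeg (const2 (1 - a ^ 2) * var 1) < tdeg (const2 (- (a ^ 3)) * wild_invariant)"
    using assms tdeg_const_mult_le[of "1 - a ^ 2" "var 1"] by (simp add: tdeg_wild_invariant)
  then have "tdeg (const2 (1 - a ^ 2) * var 1 + const2 (- (a ^ 3)) * wild_invariant) = m"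
    using assms by (simp add: tdeg_add_eq_right tdeg_wild_invariant)
  then have "tdeg (wild_conj (var 1)) = m"
    by (simp add: wild_conj_var1 assms const2_simps)
  moreover have "tdeg (const2 (1 + a ^ 2) * wild_invariant + const2 a * var 1) \<le> m"
    using assms tdeg_const_mult_le[of "1 + a ^ 2" wild_invariant] tdeg_const_mult_le[of a "var 1"]
    by (intro tdeg_add_le) (simp_all add: tdeg_wild_invariant)
  ultimately show ?thesis by (simp only: wild_conj_relation[OF assms(2)])
qed

end

lemma additive_poly_combine:
  assumes "additive_poly f" "additive_poly g"
  shows "additive_poly (f + g)" "additive_poly (f - g)"
  using assms unfolding additive_poly_def Let_def
  by (simp_all add: hom_simps[OF is_hom_subst2[OF is_hom_const2_const2]] const2_simps algebra_simps)

lemma additive_poly_const_mult: "additive_poly f \<Longrightarrow> additive_poly (const2 c * f)"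
  unfolding additive_poly_def Let_def
  by (simp add: hom_mult[OF is_hom_subst2[OF is_hom_const2_const2]] const2_simps algebra_simps)

lemma additive_poly_var: "additive_poly (var i)"
  unfolding additive_poly_def Let_def by (simp add: is_hom_const2_const2)

lemma additive_poly_power:
  fixes f :: "'a::idom poly poly"
  assumes "prime CHAR('a)" "additive_poly f"
  shows "additive_poly (f ^ CHAR('a))"
  using assms unfolding additive_poly_def Let_def
  by (simp add: hom_power[OF is_hom_subst2[OF is_hom_const2_const2]] freshmans_dream)

lemma additive_poly_cancel:
  assumes "c \<noteq> 0" "additive_poly (const2 c * f)"
  shows "additive_poly f"
  using assms unfolding additive_poly_def Let_def
  by (simp add: hom_mult[OF is_hom_subst2[OF is_hom_const2_const2]] const2_simps flip: distrib_left)

text \<open>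
  All ingredients are additive for \<open>m = p\<close>; the second coordinate is obtained after division by \<open>a\<close>.
\<close>

lemma wild_Add2:
  fixes a :: "'a::idom"
  assumes p: "prime CHAR('a)" and a: "a \<noteq> 0"
  shows "wild a CHAR('a) c \<in> Add2"
proof -
  note comb = additive_poly_combine additive_poly_const_mult additive_poly_var additive_poly_power[OF p]
  have w: "additive_poly (wild_invariant a CHAR('a))"
    unfolding wild_invariant_def by (intro comb)
  have 1: "additive_poly (wild1 a CHAR('a) c)"
    unfolding wild1_def by (intro comb w)
  have "const2 a * wild2 a CHAR('a) c = wild_invariant a CHAR('a) - wild1 a CHAR('a) c ^ CHAR('a)"
    using wild2_eq[of a "CHAR('a)" c] by (simp add: algebra_simps)
  moreover have "additive_poly (wild_invariant a CHAR('a) - wild1 a CHAR('a) c ^ CHAR('a))"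
    by (intro comb w 1)
  ultimately have "additive_poly (const2 a * wild2 a CHAR('a) c)" by simp
  then have "additive_poly (wild2 a CHAR('a) c)" by (rule additive_poly_cancel[OF a])
  then show ?thesis using 1 wild_Aut[OF a, of "CHAR('a)" c] by (simp add: Add2_def wild_def)
qed

lemma partial_deriv_power:
  "partial_deriv i (F ^ m) = of_nat m * F ^ (m - 1) * partial_deriv i (F :: 'a::idom poly poly)"
proof -
  have "const2 (of_nat m) = (of_nat m :: 'a poly poly)"
    by (induction m) (simp_all add: const2_simps)
  then show ?thesis
    using partial_deriv_ev[of i "monom 1 m" F] by (simp add: ev_monom const2_simps(1) pderiv_monom)
qed

lemma of_nat_poly_poly_CHAR: "(of_nat CHAR('a::idom) :: 'a poly poly) = 0"
  by (simp add: of_nat_eq_0_iff_char_dvd)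

text \<open>
  If \<open>p\<close> divides \<open>m\<close>, then \<open>x\<^sub>1\<^sup>m\<close> has derivative zero and \<open>wild c\<close> has the Jacobian of its linear part.
\<close>

lemma wild_Affd2:
  fixes a :: "'a::idom"
  assumes m: "CHAR('a) dvd m" and a: "a \<noteq> 0"
  shows "wild a m c \<in> Affd2"
proof -
  have m0: "(of_nat m :: 'a poly poly) = 0"
    using m by (simp add: of_nat_eq_0_iff_char_dvd)
  have w: "partial_deriv j (wild_invariant a m) = const2 (if j = 2 then a else 0)" for j
    by (simp add: wild_invariant_def partial_deriv_add partial_deriv_mult partial_deriv_power m0 partial_deriv_var const2_simps)
  have 1: "partial_deriv j (wild1 a m c) = const2 (if j = 1 then 1 else c * a * a)" for j
    using exhaust_2[of j]
    by (auto simp: wild1_def partial_deriv_add partial_deriv_mult w partial_deriv_var const2_simps)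
  have "const2 a * partial_deriv j (wild2 a m c) = const2 (if j = 2 then a else 0)" for j
    using arg_cong[OF wild2_eq[of a m c], of "partial_deriv j"]
    by (simp add: partial_deriv_add partial_deriv_mult partial_deriv_power m0 w)
  then have "const2 a * partial_deriv j (wild2 a m c) = const2 a * const2 (if j = 2 then 1 else 0)" for j
    by (simp add: const2_simps)
  then have 2: "partial_deriv j (wild2 a m c) = const2 (if j = 2 then 1 else 0)" for j
    using a by (metis const2_eq_0_iff mult_left_cancel)
  show ?thesis
    unfolding Affd2_iff using wild_Aut[OF a, of m c]
    by (intro conjI exI[of _ 1] exI[of _ "c * a * a"] exI[of _ 0] exI[of _ "1::'a"])
      (simp_all add: wild_def 1 2 const2_simps)
qed

section \<open>Non-normality\<close>

lemma carrier_Aut2_sub: "Aff2 \<subseteq> carrier Aut2" "Add2 \<subseteq> carrier Aut2" "Transl2 \<subseteq> carrier Aut2" "Affd2 \<subseteq> carrier Aut2"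
  by (auto simp: Aff2_def Add2_def Transl2_def Affd2_def)

lemma subgroup_generate_Aut2: "S \<subseteq> carrier Aut2 \<Longrightarrow> subgroup (generate Aut2 S) Aut2"
  by (rule group.generate_is_subgroup[OF group_Aut2])

lemma subgroup_T2: "subgroup T2 Aut2"
proof -
  have "subgroup E2 Aut2" unfolding E2_def by (rule subgroup_generate_Aut2) (auto simp: elementary_def)
  then show ?thesis
    unfolding T2_def using carrier_Aut2_sub subgroup.subset by (intro subgroup_generate_Aut2) blast
qed

lemma subgroup_Affg2: "subgroup Affg2 Aut2"
  unfolding Affg2_def using carrier_Aut2_sub by (intro subgroup_generate_Aut2) blast

lemma subgroup_Tg2: "subgroup Tg2 Aut2"
  unfolding Tg2_def using subgroup.subset[OF subgroup_T2] subgroup.subset[OF subgroup_Affg2]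
  by (intro subgroup_generate_Aut2) blast

lemma subgroup_Td2: "subgroup Td2 Aut2"
  unfolding Td2_def using subgroup.subset[OF subgroup_T2] carrier_Aut2_sub
  by (intro subgroup_generate_Aut2) blast

lemma T2_subset_Tg2: "T2 \<subseteq> Tg2"
  unfolding Tg2_def by (auto intro: generate.incl)

lemma shear_T2: "shear f \<in> T2"
proof -
  have "elementary (shear f)"
    unfolding elementary_def
    by (intro conjI exI[of _ 2] exI[of _ 1] exI[of _ "1::'a"] exI[of _ f])
      (simp_all add: shear_Aut const2_simps ev_def[symmetric])
  then show ?thesis unfolding T2_def E2_def by (intro generate.incl UnI2) simp
qed

lemma not_normal_if_wild_conj:
  fixes a :: "'a::idom"
  assumes K: "subgroup K Aut2" and H: "T2 \<subseteq> H" and a: "a \<noteq> 0"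
    and wild: "wild a m 1 \<in> K" and out: "wild_conj a m \<notin> H"
  shows "\<not> H \<lhd> Aut2\<lparr>carrier := K\<rparr>"
proof
  assume "H \<lhd> Aut2\<lparr>carrier := K\<rparr>"
  then interpret normal H "Aut2\<lparr>carrier := K\<rparr>" .
  have "inv\<^bsub>Aut2\<lparr>carrier := K\<rparr>\<^esub> (wild a m 1) = wild a m (- 1)"
    using group.m_inv_consistent[OF group_Aut2 K wild] inv_wild[OF a] by simp
  then have "wild_conj a m \<in> H"
    using inv_op_closed2[of "wild a m 1" "shear [:0, 1:]"] wild H shear_T2[of "[:0, 1:]"]
    by (auto simp: wild_conj_def)
  then show False using out by blast
qed

lemma infinite_if_not_field:
  assumes "a \<noteq> 0" "\<not> a dvd (1 :: 'a::idom)"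
  shows "infinite (UNIV :: 'a set)"
proof
  assume "finite (UNIV :: 'a set)"
  moreover have "inj (\<lambda>x. a * x)" using assms(1) by (auto intro: injI)
  ultimately have "surj (\<lambda>x. a * x)" by (rule finite_UNIV_inj_surj)
  then obtain x where "1 = a * x" by (metis surjD)
  then show False using assms(2) by (metis dvd_triv_left)
qed

text \<open>
  Let \<open>\<phi>\<close> be \<open>wild_conj\<close>. For \<open>m = p + 1\<close> the derivative of \<open>\<phi>(x\<^sub>1)\<^sup>m\<close> is \<open>\<phi>(x\<^sub>1)\<^sup>p\<close> times that of \<open>\<phi>(x\<^sub>1)\<close>. Differentiating \<open>wild_conj_relation\<close>
  therefore gives the hypothesis of the criterion with \<open>g = \<phi>(x\<^sub>1)\<^sup>p\<close>, which is \<open>x\<^sub>1\<^sup>p\<close> modulo \<open>a\<close> and so is not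
  constant.
\<close>

lemma wild_conj_outside_Td2:
  fixes a :: "'a::idom"
  assumes p: "prime CHAR('a)" and a: "a \<noteq> 0" "\<not> a dvd 1"
  shows "wild_conj a (CHAR('a) + 1) \<notin> Td2"
proof -
  define p where "p = CHAR('a)"
  have p1: "p > 1" using p prime_gt_1_nat by (simp add: p_def)
  define m where "m = p + 1"
  have m1: "(of_nat m :: 'a poly poly) = 1" using of_nat_poly_poly_CHAR[where ?'a = 'a] by (simp add: m_def p_def)
  let ?\<phi> = "wild_conj a m" and ?w = "wild_invariant a m"
  define F where "F = ?\<phi> (var 1)"
  have F: "F = const2 (1 - a ^ 2) * var 1 - const2 (a ^ 3) * ?w"
    by (simp add: F_def wild_conj_var1 a)
  have w: "partial_deriv 1 ?w = var 1 ^ p"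
    by (simp add: wild_invariant_def partial_deriv_add partial_deriv_mult partial_deriv_power m1 partial_deriv_var, simp add: m_def)
  have pm: "partial_deriv 1 (- f) = - partial_deriv 1 f" for f :: "'a poly poly"
    using partial_deriv_add[of 1 f "- f"] partial_deriv_const2[of 1 "0::'a"] by (simp add: const2_simps eq_neg_iff_add_eq_0 add.commute)
  have dF: "partial_deriv 1 F = const2 (1 - a ^ 2) - const2 (a ^ 3) * var 1 ^ p"
    using partial_deriv_add[of 1 "const2 (1 - a ^ 2) * var 1" "- (const2 (a ^ 3) * ?w)"]
    by (simp add: F pm partial_deriv_mult w partial_deriv_var)
  have tF: "tdeg (partial_deriv 1 F) = p"
  proof -
    have "tdeg (const2 (1 - a ^ 2)) < tdeg (const2 (- (a ^ 3)) * var 1 ^ p)"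
      using a p1 by (simp add: tdeg_power)
    then have "tdeg (const2 (1 - a ^ 2) + const2 (- (a ^ 3)) * var 1 ^ p) = p"
      using a by (simp add: tdeg_add_eq_right tdeg_power)
    then show ?thesis by (simp add: dF const2_simps)
  qed
  have "const2 a * partial_deriv 1 (?\<phi> (var 2)) + F ^ p * partial_deriv 1 F
      = const2 (1 + a ^ 2) * var 1 ^ p + const2 a"
    using arg_cong[OF wild_conj_relation[OF a(1), of m], of "partial_deriv 1", folded F_def]
    by (simp add: partial_deriv_add partial_deriv_mult partial_deriv_power m1 w partial_deriv_var, simp add: m_def)
  moreover have "tdeg (const2 (1 + a ^ 2) * var 1 ^ p + const2 a) \<le> p"
    using tdeg_const_mult_le[of "1 + a ^ 2" "var 1 ^ p"] by (simp add: tdeg_power)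
  ultimately have le: "tdeg (const2 a * partial_deriv 1 (?\<phi> (var 2)) + F ^ p * partial_deriv 1 F) \<le> tdeg (partial_deriv 1 F)"
    by (simp only: tF)
  have nz: "partial_deriv 1 F \<noteq> 0" using tF p1 by auto
  have "\<nexists>c h. F ^ p = const2 c + const2 a * h"
  proof
    assume "\<exists>c h. F ^ p = const2 c + const2 a * h"
    then obtain c h where ch: "F ^ p = const2 c + const2 a * h" by blast
    define q where "q = - const2 a * var 1 - const2 (a ^ 2) * ?w"
    have "F = var 1 + const2 a * q"
      by (simp add: F q_def const2_simps algebra_simps power2_eq_square power3_eq_cube)
    then have "F ^ p = var 1 ^ p + (const2 a * q) ^ p"
      using freshmans_dream[where ?'a = "'a poly poly", of p "var 1" "const2 a * q"] p by (simp add: p_def)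
    also have "(const2 a * q) ^ p = const2 a * (q * (const2 a * q) ^ (p - 1))"
      using p1 by (metis gr_zeroI mult.assoc not_one_less_zero power_minus_mult mult.commute)
    finally have "var 1 ^ p = const2 c + const2 a * (h - q * (const2 a * q) ^ (p - 1))"
      using ch by (simp add: algebra_simps)
    then have eq: "coeff (coeff (var 1 ^ p) 0) p
        = coeff (coeff (const2 c + const2 a * (h - q * (const2 a * q) ^ (p - 1))) 0) p"
      by simp
    have "(var 1 :: 'a poly poly) ^ p = [:monom 1 p:]"
      using ev_var1[of "monom 1 p"] by (simp add: ev_monom const2_simps)
    then have "coeff (coeff (var 1 ^ p :: 'a poly poly) 0) p = 1" by simp
    moreover have "coeff (coeff (const2 c + const2 a * r) 0) p = a * coeff (coeff r 0) p" for r
      using p1 by (cases p) (simp_all add: const2_def)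
    ultimately have "a dvd 1" using eq by (metis dvd_triv_left)
    then show False using a(2) by blast
  qed
  then show ?thesis
    using outside_Td2[OF wild_conj_Aut[OF a(1)] a(1) _ nz[unfolded F_def] le[unfolded F_def]]
    by (simp add: m_def p_def F_def)
qed

theorem theorem1p3:
  assumes "CHAR('a::idom) > 0"
    and "\<not> (\<forall>a::'a. a \<noteq> 0 \<longrightarrow> a dvd 1)"
  shows "subgroup (T2 :: 'a endo2 set) (Aut2\<lparr>carrier := Tg2\<rparr>) \<and>
    subgroup (Tg2 :: 'a endo2 set) (Aut2\<lparr>carrier := Td2\<rparr>) \<and>
    subgroup (Td2 :: 'a endo2 set) Aut2 \<and>
    \<not> (T2 :: 'a endo2 set) \<lhd> Aut2\<lparr>carrier := Tg2\<rparr> \<and>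
    \<not> (Tg2 :: 'a endo2 set) \<lhd> Aut2\<lparr>carrier := Td2\<rparr> \<and>
    \<not> (Td2 :: 'a endo2 set) \<lhd> Aut2 \<and>
    distinct [T2 :: 'a endo2 set, Tg2, Td2, carrier Aut2]"
proof -
  interpret Aut: group "Aut2 :: 'a endo2 monoid" by (rule group_Aut2)
  define p where "p = CHAR('a)"
  have p: "prime p" using prime_CHAR_semidom assms(1) by (auto simp: p_def)
  then have p1: "p > 1" by (rule prime_gt_1_nat)
  obtain a :: 'a where a: "a \<noteq> 0" "\<not> a dvd 1" using assms(2) by blast
  have inf: "infinite (UNIV :: 'a set)" using a by (rule infinite_if_not_field)
  interpret lin: frobenius_power 1 "TYPE('a)" by unfold_locales simp
  interpret add: frobenius_power p "TYPE('a)" by unfold_locales (use p in \<open>simp add: p_def\<close>)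
  have GAff: "Transl2 \<subseteq> add.GAff" "Add2 \<subseteq> add.GAff" "add.GAff \<subseteq> Affd2"
    using Transl2_subset_Aff2 add.Aff2_subset_GAff add.Add2_subset_GAff[OF inf p_def p] add.GAff_subset_Affd2
    by blast+
  have Affg2: "Affg2 \<subseteq> add.GAff"
    unfolding Affg2_def using GAff by (intro Aut.generate_subgroup_incl add.subgroup_GAff) blast
  have Tg2_Td2: "(Tg2 :: 'a endo2 set) \<subseteq> Td2"
    unfolding Tg2_def Td2_def using Affg2 GAff(3) by (intro Aut.mono_generate) blast
  have Tg2_gen: "(Tg2 :: 'a endo2 set) \<subseteq> generate Aut2 (add.GAff \<union> T2)"
    unfolding Tg2_def using Affg2 by (intro Aut.mono_generate) blast
  have T2_gen: "(T2 :: 'a endo2 set) \<subseteq> generate Aut2 (lin.GAff \<union> T2)"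
    by (auto intro: generate.incl)

  \<comment> \<open>For \<open>m = p\<close> the automorphism \<open>wild\<close> is additive, but \<open>x\<^sub>1\<^sup>p\<close> is not linear.\<close>
  have "p \<notin> range ((^) 1)" using p1 by auto
  then have "wild_conj a p \<notin> T2"
    using lin.outside_generated[OF wild_conj_Aut[OF a(1)] a, of p p] T2_gen
      tdeg_wild_conj[OF p1 a(1)] p1 by auto
  moreover have "wild a p 1 \<in> Affg2"
    using wild_Add2[OF p[unfolded p_def] a(1), of 1] unfolding Affg2_def p_def
    by (intro generate.incl UnI2)
  then have "wild a p 1 \<in> Tg2"
    unfolding Tg2_def by (intro generate.incl UnI1)
  ultimately have 1: "\<not> (T2 :: 'a endo2 set) \<lhd> Aut2\<lparr>carrier := Tg2\<rparr>"
    by (intro not_normal_if_wild_conj[OF subgroup_Tg2 order_refl a(1)])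

  \<comment> \<open>A multiple of \<open>p\<close> that is not a power of \<open>p\<close>: the Jacobian of \<open>wild\<close> is constant, but \<open>x\<^sub>1\<^sup>m\<close> is not additive.\<close>
  define m where "m = p * (p + 1)"
  have m1: "m > 1" using p1 by (simp add: m_def)
  have "m \<notin> range ((^) p)"
  proof
    assume "m \<in> range ((^) p)"
    then obtain k where "p * (p + 1) = p ^ k" by (auto simp: m_def)
    then have "(p + 1) dvd p ^ k" by (metis dvd_triv_right)
    moreover have "coprime (p + 1) (p ^ k)" by simp
    ultimately have "p + 1 = 1" by (metis coprime_common_divisor_nat dvd_refl)
    then show False using p1 by simp
  qed
  then have "wild_conj a m \<notin> Tg2"
    using add.outside_generated[OF wild_conj_Aut[OF a(1)] a, of m m] Tg2_gen
      tdeg_wild_conj[OF m1 a(1)] m1 by auto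
  moreover have "wild a m 1 \<in> Td2"
    using wild_Affd2[OF _ a(1), of m 1] unfolding Td2_def by (intro generate.incl UnI1) (simp add: m_def p_def)
  ultimately have 2: "\<not> (Tg2 :: 'a endo2 set) \<lhd> Aut2\<lparr>carrier := Td2\<rparr>"
    by (intro not_normal_if_wild_conj[OF subgroup_Td2 T2_subset_Tg2 a(1)])

  have "wild_conj a (p + 1) \<notin> Td2"
    using wild_conj_outside_Td2[OF p[unfolded p_def] a] by (simp add: p_def)
  then have "\<not> (Td2 :: 'a endo2 set) \<lhd> Aut2\<lparr>carrier := carrier Aut2\<rparr>"
    using T2_subset_Tg2 Tg2_Td2 wild_Aut[OF a(1), of "p + 1" 1]
    by (intro not_normal_if_wild_conj[OF Aut.subgroup_self _ a(1)]) auto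
  then have 3: "\<not> (Td2 :: 'a endo2 set) \<lhd> Aut2" by simp

  have self: "H \<lhd> Aut2\<lparr>carrier := H\<rparr>" if "subgroup H Aut2" for H :: "'a endo2 set"
    using group.normal_self[OF subgroup.subgroup_is_group[OF that group_Aut2]] by simp
  have "T2 \<noteq> (Tg2 :: 'a endo2 set)" "Tg2 \<noteq> (Td2 :: 'a endo2 set)" "Td2 \<noteq> carrier (Aut2 :: 'a endo2 monoid)"
    using 1 2 3 self[OF subgroup_Tg2] self[OF subgroup_Td2] Aut.normal_self by auto
  then have "distinct [T2 :: 'a endo2 set, Tg2, Td2, carrier Aut2]"
    using T2_subset_Tg2 Tg2_Td2 subgroup.subset[OF subgroup_Td2] by auto
  then show ?thesis
    using 1 2 3 subgroup_Td2 Aut.subgroup_incl[OF subgroup_T2 subgroup_Tg2 T2_subset_Tg2]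
      Aut.subgroup_incl[OF subgroup_Tg2 subgroup_Td2 Tg2_Td2] by blast
qed

end
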